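(* Let $K_1,\dots,K_g\in\mathrm U(r)$. Let $(F_1,F_2)$ be the unique solution of Problem H with normalisation (F), and $(G_1,G_2)$ the unique solution of Problem H with normalisation (G). Then the $2r\times2r$ matrix function $$N(z)=\begin{pmatrix}c(z)F_1(z)&s(z)F_2(z)\\-s(z)G_1(z)&c(z)G_2(z)\end{pmatrix},\qquad z\in\mathbb C\setminus[a_0,b_g],$$ solves the following Riemann–Hilbert problem: (N0) $N:\mathbb C\setminus[a_0,b_g]\to\mathbb C^{2r\times2r}$ is holomorphic; (N1) $N_+=N_-\begin{pmatrix}0&I_r\\-I_r&0\end{pmatrix}$ on $(a_k,b_k)$, $k=0,\dots,g$; (N2) $N_+=N_-\operatorname{diag}(K_j,K_j^{-1})$ on $(b_{j-1},a_j)$, $j=1,\dots,g$; (N3) $N(z)=I_{2r}+O(z^{-1})$ as $z\to\infty$; (N4) $N(z)=O(|z-e|^{-1/4})$ as $z\to e$, for each $e\in\{a_0,b_0,\dots,a_g,b_g\}$.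
   Context: Fix $g\ge0$, $r\ge1$ and real numbers $a_0<b_0<a_1<\cdots<a_g<b_g$; $E=\bigcup_{\ell=0}^g[a_\ell,b_\ell]$, $\widehat{\mathbb C}=\mathbb C\cup\{\infty\}$, $\Omega_0=\widehat{\mathbb C}\setminus[a_0,b_g]$. Cuts: $(a_k,b_k)$, $k=0,\dots,g$. Gaps: $\Sigma_j=(b_{j-1},a_j)$, $j=1,\dots,g$. $F_\pm(x)$ denotes the (continuous) boundary value from $\{\pm\operatorname{Im}z>0\}$. $\mathrm U(r)$: $r\times r$ unitary matrices. Scalar functions: $\beta(z)=\prod_{\nu=0}^g\left(\frac{z-b_\nu}{z-a_\nu}\right)^{1/4}$ on $\widehat{\mathbb C}\setminus E$, each factor the principal fourth root (so $\beta(\infty)=1$), $c=\frac{\beta+\beta^{-1}}2$, $s=\frac{\beta-\beta^{-1}}{2i}$. $\xi_j$ is the unique zero in $\Sigma_j$ of $\prod_{\ell=0}^g(z-a_\ell)-\prod_{\ell=0}^g(z-b_\ell)$. Problem H (data $K_1,\dots,K_g\in\mathrm U(r)$): find $H_1,H_2:\Omega_0\to\mathbb C^{r\times r}$ such that (H0) $H_1,H_2$ are holomorphic on $\Omega_0$; (H1) on each cut $(a_k,b_k)$: $H_{1+}=H_{2-}$, $H_{2+}=H_{1-}$; (H2) on each gap $(b_{j-1},a_j)$ (away from $\xi_j$, where a pole may occur): $H_{1+}=H_{1-}K_j$, $H_{2+}=H_{2-}K_j^{-1}$; (H3) $H_1,H_2$ are bounded near each $a_k,b_k$; together with one of the normalisations: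 (F) $H_1(\infty)=I_r$, $H_2$ bounded at $\infty$, $H_1$ bounded at each $\xi_j$, and $H_2(z)=O(|z-\xi_j|^{-1})$ as $z\to\xi_j$; (G) $H_2(\infty)=I_r$, $H_1$ bounded at $\infty$, $H_2$ bounded at each $\xi_j$, and $H_1(z)=O(|z-\xi_j|^{-1})$ as $z\to\xi_j$. With either normalisation, Problem H has a unique solution, written $(F_1,F_2)$, respectively $(G_1,G_2)$. *)

theory Defs
  imports "HOL-Complex_Analysis.Complex_Analysis" "HOL-Library.Landau_Symbols"
begin

definition interlaced :: "nat \<Rightarrow> (nat \<Rightarrow> real) \<Rightarrow> (nat \<Rightarrow> real) \<Rightarrow> bool" where
  "interlaced g a b \<longleftrightarrow> (\<forall>k\<le>g. a k < b k) \<and> (\<forall>k<g. b k < a (Suc k))"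

definition slit_plane :: "nat \<Rightarrow> (nat \<Rightarrow> real) \<Rightarrow> (nat \<Rightarrow> real) \<Rightarrow> complex set" where
  "slit_plane g a b = - (complex_of_real ` {a 0..b g})"

definition cut :: "(nat \<Rightarrow> real) \<Rightarrow> (nat \<Rightarrow> real) \<Rightarrow> nat \<Rightarrow> real set" where
  "cut a b k = {a k<..<b k}"

definition gap :: "(nat \<Rightarrow> real) \<Rightarrow> (nat \<Rightarrow> real) \<Rightarrow> nat \<Rightarrow> real set" where
  "gap a b j = {b (j - 1)<..<a j}"

definition endpoints :: "nat \<Rightarrow> (nat \<Rightarrow> real) \<Rightarrow> (nat \<Rightarrow> real) \<Rightarrow> real set" where
  "endpoints g a b = a ` {..g} \<union> b ` {..g}"

text \<open>Complex \<open>powr\<close> is the principal branch; on the slit plane no quotient below is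
  real and nonpositive.\<close>
definition beta :: "nat \<Rightarrow> (nat \<Rightarrow> real) \<Rightarrow> (nat \<Rightarrow> real) \<Rightarrow> complex \<Rightarrow> complex" where
  "beta g a b z =
     (\<Prod>\<nu>\<le>g. ((z - complex_of_real (b \<nu>)) / (z - complex_of_real (a \<nu>))) powr (1 / 4))"

definition c_fun :: "nat \<Rightarrow> (nat \<Rightarrow> real) \<Rightarrow> (nat \<Rightarrow> real) \<Rightarrow> complex \<Rightarrow> complex" where
  "c_fun g a b z = (beta g a b z + inverse (beta g a b z)) / 2"

definition s_fun :: "nat \<Rightarrow> (nat \<Rightarrow> real) \<Rightarrow> (nat \<Rightarrow> real) \<Rightarrow> complex \<Rightarrow> complex" where
  "s_fun g a b z = (beta g a b z - inverse (beta g a b z)) / (2 * \<i>)"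

definition xi :: "nat \<Rightarrow> (nat \<Rightarrow> real) \<Rightarrow> (nat \<Rightarrow> real) \<Rightarrow> nat \<Rightarrow> real" where
  "xi g a b j = (THE x. x \<in> gap a b j \<and> (\<Prod>l\<le>g. x - a l) - (\<Prod>l\<le>g. x - b l) = 0)"

lemma xi_ex1:
  assumes il: "interlaced g a b" and j: "j \<in> {1..g}"
  shows "\<exists>!x. x \<in> gap a b j \<and> (\<Prod>l\<le>g. x - a l) - (\<Prod>l\<le>g. x - b l) = 0"
proof -
  have ab: "a k < b k" if "k \<le> g" for k using il that by (auto simp: interlaced_def)
  have ba: "b k < a (Suc k)" if "k < g" for k using il that by (auto simp: interlaced_def)
  have bmono: "k \<le> n \<Longrightarrow> n \<le> g \<Longrightarrow> b k \<le> b n" for k n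
  proof (induction n rule: dec_induct)
    case (step n)
    then show ?case using ab[of "Suc n"] ba[of n] by simp
  qed simp
  have amono: "k \<le> n \<Longrightarrow> n \<le> g \<Longrightarrow> a k \<le> a n" for k n
  proof (induction n rule: dec_induct)
    case (step n)
    then show ?case using ab[of n] ba[of n] by simp
  qed simp
  have jg: "1 \<le> j" "j \<le> g" using j by auto
  define p where "p = b (j - 1)"
  define q where "q = a j"
  have pq: "p < q" using ba[of "j - 1"] jg by (simp add: p_def q_def)
  have left: "a l < b l \<and> b l \<le> p" if "l < j" for l
    using that bmono[of l "j - 1"] ab[of l] jg by (auto simp: p_def)
  have right: "q \<le> a l \<and> a l < b l" if "j \<le> l" "l \<le> g" for l
    using that amono[of j l] ab[of l] by (auto simp: q_def)
  define \<sigma> :: "nat \<Rightarrow> real" where "\<sigma> l = (if l < j then 1 else -1)" for l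
  define A where "A x = (\<Prod>l\<le>g. \<sigma> l * (x - a l))" for x
  define B where "B x = (\<Prod>l\<le>g. \<sigma> l * (x - b l))" for x
  have sig: "(\<Prod>l\<le>g. \<sigma> l) \<noteq> 0" by (simp add: \<sigma>_def)
  have eq: "A x - B x = (\<Prod>l\<le>g. \<sigma> l) * ((\<Prod>l\<le>g. x - a l) - (\<Prod>l\<le>g. x - b l))" for x
    unfolding A_def B_def prod.distrib by (rule right_diff_distrib[symmetric])
  have zero_iff: "(\<Prod>l\<le>g. x - a l) - (\<Prod>l\<le>g. x - b l) = 0 \<longleftrightarrow> A x = B x" for x
    using eq[of x] sig by (metis eq_iff_diff_eq_0 mult_eq_0_iff)
  have Apos: "\<sigma> l * (x - a l) > 0" if "l \<le> g" "p \<le> x" "x < q" for l x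
    using left[of l] right[of l] that by (auto simp: \<sigma>_def)
  have Bpos: "\<sigma> l * (x - b l) > 0" if "l \<le> g" "p < x" "x \<le> q" for l x
    using left[of l] right[of l] that by (auto simp: \<sigma>_def)
  have "B p = 0" unfolding B_def
    by (rule prod_zero) (use jg in \<open>auto simp: p_def intro!: bexI[of _ "j - 1"]\<close>)
  moreover have "A p > 0" unfolding A_def by (rule prod_pos) (use Apos pq in auto)
  moreover have "A q = 0" unfolding A_def
    by (rule prod_zero) (use jg in \<open>auto simp: q_def intro!: bexI[of _ j]\<close>)
  moreover have "B q > 0" unfolding B_def by (rule prod_pos) (use Bpos pq in auto)
  moreover have "continuous_on {p..q} (\<lambda>x. B x - A x)"
    unfolding A_def B_def by (intro continuous_intros)
  ultimately obtain x where x: "p \<le> x" "x \<le> q" "B x - A x = 0"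
    using IVT'[of "\<lambda>x. B x - A x" p 0 q] pq by force
  have "x \<noteq> p" "x \<noteq> q"
    using x \<open>B p = 0\<close> \<open>A p > 0\<close> \<open>A q = 0\<close> \<open>B q > 0\<close> by auto
  with x have xin: "p < x" "x < q" "A x = B x" by auto
  have mono: "B y / A y < B z / A z" if "p < y" "y < z" "z < q" for y z
  proof -
    have step: "0 < (y - b l) / (y - a l) \<and> (y - b l) / (y - a l) < (z - b l) / (z - a l)"
      if l: "l \<le> g" for l
    proof -
      have Y: "\<sigma> l * (y - a l) > 0" "\<sigma> l * (y - b l) > 0"
        and Z: "\<sigma> l * (z - a l) > 0" "\<sigma> l * (z - b l) > 0"
        using Apos Bpos l \<open>p < y\<close> \<open>y < z\<close> \<open>z < q\<close> by auto
      have pos: "0 < (y - b l) / (y - a l)"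
        using Y by (auto simp: \<sigma>_def zero_less_divide_iff split: if_splits)
      have ya: "0 < (y - a l) * (z - a l)"
        using Y Z by (auto simp: \<sigma>_def zero_less_mult_iff split: if_splits)
      then have "y - a l \<noteq> 0" "z - a l \<noteq> 0" by auto
      then have "(z - b l) / (z - a l) - (y - b l) / (y - a l)
            = (b l - a l) * (z - y) / ((y - a l) * (z - a l))"
        by (simp add: diff_frac_eq) (simp add: algebra_simps)
      also have "\<dots> > 0" using ya ab[OF l] \<open>y < z\<close> by simp
      finally show ?thesis using pos by simp
    qed
    have "(\<Prod>l\<le>g. (y - b l) / (y - a l)) < (\<Prod>l\<le>g. (z - b l) / (z - a l))"
    proof (rule prod_mono_strict[of 0])
      show "0 \<le> (y - b l) / (y - a l) \<and> (y - b l) / (y - a l) \<le> (z - b l) / (z - a l)"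
        if "l \<in> {..g}" for l
        using step[of l] that by (metis atMost_iff less_imp_le)
      show "0 < (z - b l) / (z - a l)" if "l \<in> {..g}" for l
        using step[of l] that by (metis atMost_iff less_trans)
    qed (use step[of 0] in simp_all)
    moreover have "B x / A x = (\<Prod>l\<le>g. (x - b l) / (x - a l))" for x
    proof -
      have "\<sigma> l * (x - b l) / (\<sigma> l * (x - a l)) = (x - b l) / (x - a l)" for l
        by (simp add: \<sigma>_def)
      then show ?thesis unfolding A_def B_def prod_dividef[symmetric] by simp
    qed
    ultimately show ?thesis by simp
  qed
  have uniq: "y = x" if "p < y" "y < q" "A y = B y" for y
  proof -
    have A_pos: "A t > 0" if "p < t" "t < q" for t
      unfolding A_def by (rule prod_pos) (use Apos that in auto)
    have q1: "B t / A t = 1" if "p < t" "t < q" "A t = B t" for t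
      using A_pos[OF that(1,2)] that(3) by simp
    show "y = x"
    proof (cases y x rule: linorder_cases)
      case less
      then show ?thesis using mono[OF that(1) less xin(2)] q1[OF that] q1[OF xin] by simp
    next
      case greater
      then show ?thesis using mono[OF xin(1) greater that(2)] q1[OF that] q1[OF xin] by simp
    qed
  qed
  show ?thesis
  proof (rule ex1I[of _ x])
    show "x \<in> gap a b j \<and> (\<Prod>l\<le>g. x - a l) - (\<Prod>l\<le>g. x - b l) = 0"
      using xin zero_iff[of x] by (simp add: gap_def p_def q_def)
    fix y assume y: "y \<in> gap a b j \<and> (\<Prod>l\<le>g. y - a l) - (\<Prod>l\<le>g. y - b l) = 0"
    then have "A y = B y" using zero_iff[of y] by blast
    moreover have "p < y" "y < q" using y by (auto simp: gap_def p_def q_def)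
    ultimately show "y = x" by (intro uniq)
  qed
qed

definition adjoint_matrix :: "complex^'n^'m \<Rightarrow> complex^'m^'n" where
  "adjoint_matrix A = map_matrix cnj (transpose A)"

definition unitary_matrix :: "complex^'n^'n \<Rightarrow> bool" where
  "unitary_matrix U \<longleftrightarrow> adjoint_matrix U ** U = mat 1 \<and> U ** adjoint_matrix U = mat 1"

definition cscale :: "complex \<Rightarrow> complex^'n^'m \<Rightarrow> complex^'n^'m" where
  "cscale k A = map_matrix (\<lambda>x. k * x) A"

text \<open>A 2r-by-2r matrix is indexed by the disjoint sum of two copies of the index type
  of size r: \<open>Inl\<close> is the first block, \<open>Inr\<close> the second.\<close>
definition block_matrix ::
  "'a^'n^'n \<Rightarrow> 'a^'n^'n \<Rightarrow> 'a^'n^'n \<Rightarrow> 'a^'n^'n \<Rightarrow> 'a^('n + 'n)^('n + 'n)" where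
  "block_matrix A B C D = (\<chi> i j. case i of
       Inl p \<Rightarrow> (case j of Inl q \<Rightarrow> A $ p $ q | Inr q \<Rightarrow> B $ p $ q)
     | Inr p \<Rightarrow> (case j of Inl q \<Rightarrow> C $ p $ q | Inr q \<Rightarrow> D $ p $ q))"

definition matrix_holomorphic_on ::
  "(complex \<Rightarrow> complex^'n^'m) \<Rightarrow> complex set \<Rightarrow> bool" where
  "matrix_holomorphic_on H S \<longleftrightarrow> (\<forall>i j. (\<lambda>z. H z $ i $ j) holomorphic_on S)"

text \<open>A function near \<open>\<infinity>\<close> on the Riemann sphere is represented by its restriction to the
  finite plane.  Holomorphy at \<open>\<infinity>\<close> is holomorphy at \<open>w = 0\<close> in the chart \<open>w = 1/z\<close>, for some
  value \<open>L\<close> at \<open>\<infinity>\<close>; this \<open>L\<close> is necessarily the limit of \<open>H\<close> along \<open>at_infinity\<close>.\<close>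
definition matrix_holomorphic_at_infinity ::
  "(complex \<Rightarrow> complex^'n^'m) \<Rightarrow> bool" where
  "matrix_holomorphic_at_infinity H \<longleftrightarrow>
     (\<exists>L. \<forall>i j. (\<lambda>w. (if w = 0 then L else H (inverse w)) $ i $ j) analytic_on {0})"

definition bv_plus :: "(complex \<Rightarrow> 'a::t2_space) \<Rightarrow> real \<Rightarrow> 'a" where
  "bv_plus F x = Lim (at (complex_of_real x) within {z. Im z > 0}) F"

definition bv_minus :: "(complex \<Rightarrow> 'a::t2_space) \<Rightarrow> real \<Rightarrow> 'a" where
  "bv_minus F x = Lim (at (complex_of_real x) within {z. Im z < 0}) F"

text \<open>\<open>Lim\<close> is a total function, so the existence of the limits is stated separately.\<close>
definition has_continuous_bvs_on :: "(complex \<Rightarrow> 'a::t2_space) \<Rightarrow> real set \<Rightarrow> bool" where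
  "has_continuous_bvs_on F I \<longleftrightarrow>
     (\<forall>x\<in>I. (F \<longlongrightarrow> bv_plus F x) (at (complex_of_real x) within {z. Im z > 0}) \<and>
            (F \<longlongrightarrow> bv_minus F x) (at (complex_of_real x) within {z. Im z < 0})) \<and>
     continuous_on I (bv_plus F) \<and> continuous_on I (bv_minus F)"

definition problem_H ::
  "nat \<Rightarrow> (nat \<Rightarrow> real) \<Rightarrow> (nat \<Rightarrow> real) \<Rightarrow> (nat \<Rightarrow> complex^'r^'r) \<Rightarrow>
   (complex \<Rightarrow> complex^'r^'r) \<Rightarrow> (complex \<Rightarrow> complex^'r^'r) \<Rightarrow> bool" where
  "problem_H g a b K H1 H2 \<longleftrightarrow>
     (\<forall>H\<in>{H1, H2}. matrix_holomorphic_on H (slit_plane g a b) \<and>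
                  matrix_holomorphic_at_infinity H) \<and>
     (\<forall>k\<le>g. has_continuous_bvs_on H1 (cut a b k) \<and> has_continuous_bvs_on H2 (cut a b k) \<and>
        (\<forall>x\<in>cut a b k. bv_plus H1 x = bv_minus H2 x \<and> bv_plus H2 x = bv_minus H1 x)) \<and>
     (\<forall>j\<in>{1..g}. has_continuous_bvs_on H1 (gap a b j - {xi g a b j}) \<and>
        has_continuous_bvs_on H2 (gap a b j - {xi g a b j}) \<and>
        (\<forall>x\<in>gap a b j - {xi g a b j}.
           bv_plus H1 x = bv_minus H1 x ** K j \<and>
           bv_plus H2 x = bv_minus H2 x ** matrix_inv (K j))) \<and>
     (\<forall>H\<in>{H1, H2}. \<forall>e\<in>endpoints g a b.
        (\<lambda>z. norm (H z)) \<in> O[at (complex_of_real e) within slit_plane g a b](\<lambda>_. 1))"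

text \<open>The two normalisations differ by exchanging the two functions: \<open>P\<close> is the one normalised
  at \<open>\<infinity>\<close>, \<open>Q\<close> the one that may have poles at the points \<open>\<xi>\<^sub>j\<close>.\<close>
definition normalisation ::
  "nat \<Rightarrow> (nat \<Rightarrow> real) \<Rightarrow> (nat \<Rightarrow> real) \<Rightarrow>
   (complex \<Rightarrow> complex^'r^'r) \<Rightarrow> (complex \<Rightarrow> complex^'r^'r) \<Rightarrow> bool" where
  "normalisation g a b P Q \<longleftrightarrow>
     (P \<longlongrightarrow> mat 1) at_infinity \<and>
     (\<lambda>z. norm (Q z)) \<in> O[at_infinity](\<lambda>_. 1) \<and>
     (\<forall>j\<in>{1..g}.
        (\<lambda>z. norm (P z)) \<in> O[at (complex_of_real (xi g a b j)) within slit_plane g a b](\<lambda>_. 1) \<and>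
        (\<lambda>z. norm (Q z)) \<in> O[at (complex_of_real (xi g a b j)) within slit_plane g a b](
           \<lambda>z. 1 / norm (z - complex_of_real (xi g a b j))))"

definition solves_H_F ::
  "nat \<Rightarrow> (nat \<Rightarrow> real) \<Rightarrow> (nat \<Rightarrow> real) \<Rightarrow> (nat \<Rightarrow> complex^'r^'r) \<Rightarrow>
   (complex \<Rightarrow> complex^'r^'r) \<Rightarrow> (complex \<Rightarrow> complex^'r^'r) \<Rightarrow> bool" where
  "solves_H_F g a b K F1 F2 \<longleftrightarrow> problem_H g a b K F1 F2 \<and> normalisation g a b F1 F2"

definition solves_H_G ::
  "nat \<Rightarrow> (nat \<Rightarrow> real) \<Rightarrow> (nat \<Rightarrow> real) \<Rightarrow> (nat \<Rightarrow> complex^'r^'r) \<Rightarrow>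
   (complex \<Rightarrow> complex^'r^'r) \<Rightarrow> (complex \<Rightarrow> complex^'r^'r) \<Rightarrow> bool" where
  "solves_H_G g a b K G1 G2 \<longleftrightarrow> problem_H g a b K G1 G2 \<and> normalisation g a b G2 G1"

definition N_matrix ::
  "nat \<Rightarrow> (nat \<Rightarrow> real) \<Rightarrow> (nat \<Rightarrow> real) \<Rightarrow>
   (complex \<Rightarrow> complex^'r^'r) \<Rightarrow> (complex \<Rightarrow> complex^'r^'r) \<Rightarrow>
   (complex \<Rightarrow> complex^'r^'r) \<Rightarrow> (complex \<Rightarrow> complex^'r^'r) \<Rightarrow>
   complex \<Rightarrow> complex^('r + 'r)^('r + 'r)" where
  "N_matrix g a b F1 F2 G1 G2 z =
     block_matrix (cscale (c_fun g a b z) (F1 z))     (cscale (s_fun g a b z) (F2 z))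
                  (cscale (- s_fun g a b z) (G1 z))   (cscale (c_fun g a b z) (G2 z))"

definition solves_RHP_N ::
  "nat \<Rightarrow> (nat \<Rightarrow> real) \<Rightarrow> (nat \<Rightarrow> real) \<Rightarrow> (nat \<Rightarrow> complex^'r^'r) \<Rightarrow>
   (complex \<Rightarrow> complex^('r + 'r)^('r + 'r)) \<Rightarrow> bool" where
  "solves_RHP_N g a b K N \<longleftrightarrow>
     matrix_holomorphic_on N (slit_plane g a b) \<and>
     (\<forall>k\<le>g. has_continuous_bvs_on N (cut a b k) \<and>
        (\<forall>x\<in>cut a b k.
           bv_plus N x = bv_minus N x ** block_matrix 0 (mat 1) (- mat 1) 0)) \<and>
     (\<forall>j\<in>{1..g}. has_continuous_bvs_on N (gap a b j) \<and>
        (\<forall>x\<in>gap a b j.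
           bv_plus N x = bv_minus N x ** block_matrix (K j) 0 0 (matrix_inv (K j)))) \<and>
     (\<lambda>z. norm (N z - mat 1)) \<in> O[at_infinity](\<lambda>z. 1 / norm z) \<and>
     (\<forall>e\<in>endpoints g a b.
        (\<lambda>z. norm (N z)) \<in> O[at (complex_of_real e) within slit_plane g a b](
           \<lambda>z. norm (z - complex_of_real e) powr (- 1 / 4)))"

end

theory Submission
  imports Defs
begin

text \<open>
  The matrix \<open>N\<close> multiplies the solutions of the two Problems H by the scalars \<open>c\<close> and \<open>s\<close>, and each
  property of \<open>N\<close> combines a property of these solutions with a property of
  \<open>\<beta>\<close>.

  On a cut exactly one factor of \<open>\<beta>\<close> has a jump: its radicand \<open>(z - b)/(z - a)\<close> meets the negative
  axis from above, respectively below, so the fourth root carries the phase \<open>e\<^sup>i\<^sup>\<pi>\<^sup>/\<^sup>4\<close>, respectively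
  its conjugate.  Hence \<open>\<beta>\<^sub>+ = \<i>\<beta>\<^sub>-\<close>, that is, \<open>c\<^sub>+ = -s\<^sub>-\<close> and \<open>s\<^sub>+ = c\<^sub>-\<close>
  (\<open>c_s_cut_limits\<close>).  Since the two solutions \<open>H\<^sub>1, H\<^sub>2\<close> are exchanged on a cut as well, the
  columns of \<open>N\<close> are exchanged with one sign.  On a gap \<open>c\<close> and \<open>s\<close> are continuous, and \<open>N\<close> inherits
  the jump \<open>diag(K, K\<inverse>)\<close> of the solutions.  At \<open>\<infinity>\<close>, \<open>\<beta>\<close> is holomorphic with value 1, so \<open>c = 1 + O(1/z)\<close>
  and \<open>s = O(1/z)\<close>: the diagonal blocks tend to the identity and the other two vanish.  At an
  endpoint one factor of \<open>\<beta>\<close> or of \<open>1/\<beta>\<close> produces the power \<open>-1/4\<close>, and everything else stays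
  bounded.

  The delicate points are the \<open>\<xi>\<^sub>j\<close>, where the solutions may have poles while \<open>N\<close> must have a limit from either
  half plane.  On a gap all radicands are positive, so \<open>\<beta>\<close> is positive, and \<open>\<beta>\<^sup>4 = 1\<close> at
  \<open>\<xi>\<^sub>j\<close>; thus \<open>\<beta> = 1\<close> and \<open>s\<close> vanishes there, which cancels the pole and leaves \<open>N\<close> bounded
  near \<open>\<xi>\<^sub>j\<close> (\<open>N_matrix_bounded_at_xi\<close>).  Multiplying \<open>N\<close> below the gap by its invertible jump
  matrix yields a function that is continuous across the punctured gap, hence holomorphic in a
  punctured disc, and bounded; by Riemann's theorem it extends to \<open>\<xi>\<^sub>j\<close>, so \<open>N\<close> has limits from both
  sides and they satisfy the same jump relation (\<open>matrix_limits_at_removable_point\<close>).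
\<close>

section \<open>Bands and gaps on the real line\<close>

lemma interlaced_less:
  assumes "interlaced g a b" "k \<le> g"
  shows "a k < b k"
  using assms by (auto simp: interlaced_def)

lemma interlaced_bands_ordered:
  assumes "interlaced g a b"
  shows "k < n \<Longrightarrow> n \<le> g \<Longrightarrow> b k < a n"
proof (induction n)
  case (Suc n)
  have *: "b n < a (Suc n)" "a n < b n"
    using assms Suc.prems by (auto simp: interlaced_def)
  show ?case
    using Suc * by (cases "k = n") auto
qed simp

lemma interlaced_bands_disjoint:
  assumes "interlaced g a b" "k \<le> g" "\<nu> \<le> g" "\<nu> \<noteq> k" "x \<in> {a k..b k}"
  shows "x \<notin> {a \<nu>..b \<nu>}"
  using interlaced_bands_ordered[OF assms(1), of k \<nu>] interlaced_bands_ordered[OF assms(1), of \<nu> k] assms(2-)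
  by (cases \<nu> k rule: linorder_cases) auto

lemma gap_bands_disjoint:
  assumes "interlaced g a b" "j \<in> {1..g}" "\<nu> \<le> g" "x \<in> gap a b j"
  shows "x \<notin> {a \<nu>..b \<nu>}"
proof (cases "\<nu> < j")
  case True
  then have "b \<nu> \<le> b (j - 1)"
    using interlaced_bands_ordered[OF assms(1), of \<nu> "j-1"] interlaced_less[OF assms(1), of "j-1"] assms(2)
    by (cases "\<nu> = j - 1") fastforce+
  then show ?thesis using assms(4) by (auto simp: gap_def)
next
  case False
  then have "a j \<le> a \<nu>"
    using interlaced_bands_ordered[OF assms(1), of j \<nu>] interlaced_less[OF assms(1), of j] assms(2,3)
    by (cases "\<nu> = j") auto
  then show ?thesis using assms(4) by (auto simp: gap_def)
qed

lemma bands_subset_hull: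
  assumes "interlaced g a b" "k \<le> g"
  shows "{a k..b k} \<subseteq> {a 0..b g}"
proof -
  have "a 0 \<le> a k"
    using interlaced_bands_ordered[OF assms(1), of 0 k] interlaced_less[OF assms(1), of 0] assms(2)
    by (cases "k = 0") auto
  moreover have "b k \<le> b g"
    using interlaced_bands_ordered[OF assms(1), of k g] interlaced_less[OF assms(1), of g] assms(2)
    by (cases "k = g") auto
  ultimately show ?thesis by auto
qed

section \<open>The scalar functions off the bands\<close>

text \<open>Solving \<open>(z - q)/(z - p) = t\<close> for \<open>z\<close> gives \<open>z = (q - t p)/(1 - t)\<close>, which for \<open>t \<le> 0\<close> is
  a convex combination of \<open>p\<close> and \<open>q\<close>.  So the principal root of the quotient is holomorphic off the segment.\<close>
lemma quotient_off_nonpos_Reals: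
  assumes "p < q" "z \<notin> complex_of_real ` {p..q}"
  shows "(z - of_real q) / (z - of_real p) \<notin> \<real>\<^sub>\<le>\<^sub>0"
proof
  assume "(z - of_real q) / (z - of_real p) \<in> \<real>\<^sub>\<le>\<^sub>0"
  then obtain t where t: "t \<le> 0" "(z - of_real q) / (z - of_real p) = of_real t"
    by (auto elim!: nonpos_Reals_cases)
  have "z \<noteq> of_real p" using assms by auto
  then have "z - of_real q = of_real t * (z - of_real p)"
    using t(2) by (simp add: field_simps)
  then have "z * of_real (1 - t) = of_real (q - t * p)"
    by (simp add: algebra_simps)
  moreover have "1 - t > 0" using t by simp
  ultimately have "z = of_real ((q - t * p) / (1 - t))"
    by (metis less_irrefl nonzero_eq_divide_eq of_real_divide of_real_eq_0_iff)
  moreover have "(q - t * p) / (1 - t) \<in> {p..q}"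
  proof -
    have "t * q \<le> t * p" using t assms by (simp add: mult_left_mono_neg)
    then show ?thesis using \<open>1 - t > 0\<close> assms by (auto simp: field_simps)
  qed
  ultimately show False using assms by blast
qed

definition root_factor :: "real \<Rightarrow> real \<Rightarrow> complex \<Rightarrow> complex" where
  "root_factor p q z = ((z - of_real q) / (z - of_real p)) powr (1/4)"

lemma beta_eq_prod: "beta g a b z = (\<Prod>\<nu>\<le>g. root_factor (a \<nu>) (b \<nu>) z)"
  by (simp add: beta_def root_factor_def)

lemma root_factor_nonzero:
  assumes "p < q" "z \<notin> complex_of_real ` {p..q}"
  shows "root_factor p q z \<noteq> 0"
  using quotient_off_nonpos_Reals[OF assms] by (auto simp: root_factor_def)

lemma root_factor_holomorphic:
  assumes "p < q" shows "root_factor p q holomorphic_on - complex_of_real ` {p..q}"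
  unfolding root_factor_def
  by (intro holomorphic_intros) (use quotient_off_nonpos_Reals[OF assms] assms in auto)

text \<open>The set \<open>E\<close>.  Its complement contains not only \<open>slit_plane\<close> but also
  the gaps, and with them the points \<open>\<xi>\<^sub>j\<close> where \<open>c\<close> and \<open>s\<close> have to be expanded.\<close>
definition bands :: "nat \<Rightarrow> (nat \<Rightarrow> real) \<Rightarrow> (nat \<Rightarrow> real) \<Rightarrow> complex set" where
  "bands g a b = complex_of_real ` (\<Union>\<nu>\<le>g. {a \<nu>..b \<nu>})"

lemma closed_bands: "closed (bands g a b)"
proof -
  have "compact (\<Union>\<nu>\<le>g. {a \<nu>..b \<nu>})" by (intro compact_UN) auto
  then have "compact (bands g a b)" unfolding bands_def
    by (intro compact_continuous_image) (auto intro: continuous_intros)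
  then show ?thesis by (rule compact_imp_closed)
qed

lemma beta_holomorphic:
  assumes "interlaced g a b"
  shows "beta g a b holomorphic_on - bands g a b"
  unfolding beta_eq_prod
  by (intro holomorphic_on_prod holomorphic_on_subset[OF root_factor_holomorphic])
     (use interlaced_less[OF assms] in \<open>auto simp: bands_def\<close>)

lemma beta_nonzero:
  assumes "interlaced g a b" "z \<notin> bands g a b"
  shows "beta g a b z \<noteq> 0"
  unfolding beta_eq_prod
  using root_factor_nonzero[OF interlaced_less[OF assms(1)]] assms(2)
  by (fastforce simp: bands_def)

lemma c_fun_holomorphic:
  assumes "interlaced g a b"
  shows "c_fun g a b holomorphic_on - bands g a b"
  unfolding c_fun_def
  by (intro holomorphic_intros beta_holomorphic assms) (use beta_nonzero[OF assms] in auto)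

lemma s_fun_holomorphic:
  assumes "interlaced g a b"
  shows "s_fun g a b holomorphic_on - bands g a b"
  unfolding s_fun_def
  by (intro holomorphic_intros beta_holomorphic assms) (use beta_nonzero[OF assms] in auto)

lemma slit_plane_subset:
  assumes "interlaced g a b" shows "slit_plane g a b \<subseteq> - bands g a b"
  using bands_subset_hull[OF assms] unfolding slit_plane_def bands_def by fast

lemma gap_off_bands:
  assumes "interlaced g a b" "j \<in> {1..g}" "x \<in> gap a b j"
  shows "complex_of_real x \<notin> bands g a b"
  using gap_bands_disjoint[OF assms(1,2) _ assms(3)] by (auto simp: bands_def)

lemma xi_props:
  assumes "interlaced g a b" "j \<in> {1..g}"
  shows "xi g a b j \<in> gap a b j" "(\<Prod>l\<le>g. xi g a b j - a l) = (\<Prod>l\<le>g. xi g a b j - b l)"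
  using theI'[OF xi_ex1[OF assms]] by (auto simp: xi_def)

text \<open>The fourth power of \<open>\<beta>\<close> is 1 at \<open>\<xi>\<^sub>j\<close> by the equation that defines this point.  Positivity of every
  radicand on a gap selects the root \<open>\<beta> = 1\<close> among the four.\<close>
lemma beta_at_xi:
  assumes il: "interlaced g a b" and j: "j \<in> {1..g}"
  shows "beta g a b (of_real (xi g a b j)) = 1"
proof -
  define x where "x = xi g a b j"
  have x: "x \<in> gap a b j" "(\<Prod>l\<le>g. x - a l) = (\<Prod>l\<le>g. x - b l)"
    using xi_props[OF il j] by (auto simp: x_def)
  have pos: "(x - b l) / (x - a l) > 0" if "l \<le> g" for l
    using gap_bands_disjoint[OF il j that x(1)] interlaced_less[OF il that]
    by (auto simp: zero_less_divide_iff)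
  have nz: "(\<Prod>l\<le>g. x - b l) \<noteq> 0" using pos by fastforce
  have "beta g a b (of_real x) = (\<Prod>l\<le>g. of_real (((x - b l) / (x - a l)) powr (1/4)))"
    unfolding beta_def
  proof (intro prod.cong refl)
    fix l assume "l \<in> {..g}"
    then have "0 \<le> (x - b l) / (x - a l)" using pos[of l] by simp
    from powr_of_real[OF this, of "1/4"]
    show "((complex_of_real x - complex_of_real (b l)) / (complex_of_real x - complex_of_real (a l))) powr (1 / 4) =
         complex_of_real (((x - b l) / (x - a l)) powr (1 / 4))" by simp
  qed
  also have "\<dots> = of_real ((\<Prod>l\<le>g. (x - b l) / (x - a l)) powr (1/4))"
    unfolding of_real_prod[symmetric]
    by (subst prod_powr_distrib) (use pos in \<open>auto intro: less_imp_le\<close>)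
  also have "(\<Prod>l\<le>g. (x - b l) / (x - a l)) = 1"
    unfolding prod_dividef using x(2) nz by simp
  finally show ?thesis by (simp add: x_def)
qed

section \<open>Boundary values from the two half planes\<close>

abbreviation at_above :: "real \<Rightarrow> complex filter" where
  "at_above x \<equiv> at (complex_of_real x) within {z. Im z > 0}"

abbreviation at_below :: "real \<Rightarrow> complex filter" where
  "at_below x \<equiv> at (complex_of_real x) within {z. Im z < 0}"

text \<open>The relation \<open>M\<^sub>+ = M\<^sub>- A\<close> at a single point, including the existence of both limits; this
  replaces the total functions \<open>bv_plus\<close> and \<open>bv_minus\<close>, which carry no such information.\<close>
abbreviation has_jump :: "(complex \<Rightarrow> complex^'n^'n) \<Rightarrow> complex^'n^'n \<Rightarrow> real \<Rightarrow> bool" where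
  "has_jump M A x \<equiv> \<exists>L. (M \<longlongrightarrow> L ** A) (at_above x) \<and> (M \<longlongrightarrow> L) (at_below x)"

lemma half_planes_nontrivial:
  shows "at_above x \<noteq> bot"
    and "at_below x \<noteq> bot"
proof -
  have "complex_of_real x islimpt {z. Im z > 0}"
    unfolding islimpt_approachable
  proof (intro allI impI)
    fix e :: real assume "e > 0"
    then show "\<exists>z\<in>{z. Im z > 0}. z \<noteq> of_real x \<and> dist z (of_real x) < e"
      by (intro bexI[of _ "Complex x (e/2)"]) (auto simp: complex_eq_iff dist_complex_def cmod_def)
  qed
  then show "at_above x \<noteq> bot"
    by (simp add: trivial_limit_within)
  have "complex_of_real x islimpt {z. Im z < 0}"
    unfolding islimpt_approachable
  proof (intro allI impI)
    fix e :: real assume "e > 0"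
    then show "\<exists>z\<in>{z. Im z < 0}. z \<noteq> of_real x \<and> dist z (of_real x) < e"
      by (intro bexI[of _ "Complex x (-e/2)"]) (auto simp: complex_eq_iff dist_complex_def cmod_def)
  qed
  then show "at_below x \<noteq> bot"
    by (simp add: trivial_limit_within)
qed

text \<open>A function that has a limit along \<open>S\<close> at every point of \<open>I\<close> has a continuous boundary function: if \<open>F\<close> is
  within \<open>e/2\<close> of \<open>L x\<close> on the part of \<open>S\<close> near \<open>x\<close>, then so are, in the limit, the boundary values at nearby points.\<close>
lemma boundary_limits_continuous:
  fixes F :: "complex \<Rightarrow> 'a::metric_space" and L :: "real \<Rightarrow> 'a"
  assumes lim: "\<And>x. x \<in> I \<Longrightarrow> (F \<longlongrightarrow> L x) (at (of_real x) within S)"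
    and nontriv: "\<And>x. x \<in> I \<Longrightarrow> at (complex_of_real x) within S \<noteq> bot"
  shows "continuous_on I L"
  unfolding continuous_on_iff
proof (intro ballI allI impI)
  fix x and e :: real assume x: "x \<in> I" and e: "e > 0"
  then have "eventually (\<lambda>z. dist (F z) (L x) < e/2) (at (of_real x) within S)"
    using tendstoD[OF lim[OF x], of "e/2"] by simp
  then obtain d where d: "d > 0"
    "\<And>z. z \<in> S \<Longrightarrow> z \<noteq> of_real x \<Longrightarrow> dist z (of_real x) < d \<Longrightarrow> dist (F z) (L x) < e/2"
    unfolding eventually_at by blast
  show "\<exists>d>0. \<forall>x'\<in>I. dist x' x < d \<longrightarrow> dist (L x') (L x) < e"
  proof (intro exI[of _ d] conjI ballI impI d(1))
    fix y assume y: "y \<in> I" "dist y x < d"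
    show "dist (L y) (L x) < e"
    proof (cases "y = x")
      case False
      have "eventually (\<lambda>z. dist (F z) (L x) \<le> e/2) (at (of_real y) within S)"
        unfolding eventually_at_topological
        by (intro exI[of _ "ball (of_real x) d - {of_real x}"])
           (use y False d(2) in \<open>auto simp: dist_commute intro!: open_delete less_imp_le\<close>)
      then have "dist (L y) (L x) \<le> e/2"
        by (intro tendsto_upperbound[OF tendsto_dist[OF lim[OF y(1)] tendsto_const]] nontriv y)
      then show ?thesis using e by simp
    qed (use e in simp)
  qed
qed

lemma bv_plus_eqI: "(F \<longlongrightarrow> L) (at_above x) \<Longrightarrow> bv_plus F x = L"
  unfolding bv_plus_def by (rule tendsto_Lim[OF half_planes_nontrivial(1)])

lemma bv_minus_eqI: "(F \<longlongrightarrow> L) (at_below x) \<Longrightarrow> bv_minus F x = L"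
  unfolding bv_minus_def by (rule tendsto_Lim[OF half_planes_nontrivial(2)])

lemma has_continuous_bvs_onI:
  fixes F :: "complex \<Rightarrow> 'a::metric_space"
  assumes "\<And>x. x \<in> I \<Longrightarrow> \<exists>L. (F \<longlongrightarrow> L) (at_above x)"
    and "\<And>x. x \<in> I \<Longrightarrow> \<exists>L. (F \<longlongrightarrow> L) (at_below x)"
  shows "has_continuous_bvs_on F I"
proof -
  have lims: "(F \<longlongrightarrow> bv_plus F x) (at_above x)"
       "(F \<longlongrightarrow> bv_minus F x) (at_below x)" if "x \<in> I" for x
    using assms[OF that] bv_plus_eqI bv_minus_eqI by metis+
  have "continuous_on I (bv_plus F)" "continuous_on I (bv_minus F)"
    using lims half_planes_nontrivial by (blast intro: boundary_limits_continuous)+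
  then show ?thesis
    using lims by (auto simp: has_continuous_bvs_on_def)
qed

section \<open>Removable singularities on the real line\<close>

text \<open>The functions \<open>f\<close> above and \<open>h\<close> below the line fit together along \<open>p\<close> to a continuous function on a
  punctured disc.  Such a function is holomorphic across the line, and its boundedness makes the
  puncture removable; the value of the extension is the common limit.\<close>
lemma limits_at_removable_point:
  fixes f h :: "complex \<Rightarrow> complex" and p :: "real \<Rightarrow> complex"
  assumes d: "0 < d"
    and hf: "f holomorphic_on {z. Im z > 0}" and hh: "h holomorphic_on {z. Im z < 0}"
    and lf: "\<And>x. x \<in> {x0 - d<..<x0 + d} - {x0} \<Longrightarrow> (f \<longlongrightarrow> p x) (at_above x)"
    and lh: "\<And>x. x \<in> {x0 - d<..<x0 + d} - {x0} \<Longrightarrow> (h \<longlongrightarrow> p x) (at_below x)"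
    and bf: "eventually (\<lambda>z. norm (f z) \<le> C) (at_above x0)"
    and bh: "eventually (\<lambda>z. norm (h z) \<le> C) (at_below x0)"
  shows "\<exists>L. (f \<longlongrightarrow> L) (at_above x0) \<and>
             (h \<longlongrightarrow> L) (at_below x0)"
proof -
  \<comment> \<open>the function glued from \<open>f\<close>, \<open>h\<close> and their common boundary values\<close>
  define F where "F z = (if Im z > 0 then f z else if Im z < 0 then h z else p (Re z))" for z
  define I where "I = {x0 - d<..<x0 + d} - {x0}"
  define U where "U = ball (complex_of_real x0) d - {of_real x0}"
  have opens: "open I" "open U" by (auto simp: I_def U_def)
  have real_U: "Re z \<in> I" "z = of_real (Re z)" if "z \<in> U" "Im z = 0" for z
  proof -
    show z: "z = of_real (Re z)" using that by (simp add: complex_eq_iff)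
    then have "dist z (of_real x0) = \<bar>Re z - x0\<bar>" by (metis dist_of_real dist_real_def)
    then show "Re z \<in> I" using that z by (auto simp: U_def I_def dist_commute)
  qed
  have p_cont: "continuous_on I p"
    using lf half_planes_nontrivial(1) unfolding I_def by (rule boundary_limits_continuous)
  have F_cont: "continuous_on U F"
    unfolding continuous_on_eq_continuous_at[OF opens(2)]
  proof
    fix z assume z: "z \<in> U"
    consider "Im z > 0" | "Im z < 0" | "Im z = 0" by linarith
    then show "isCont F z"
    proof cases
      case 1
      have "isCont f z"
        using holomorphic_on_imp_continuous_on[OF hf] 1
        by (simp add: continuous_on_eq_continuous_at open_halfspace_Im_gt)
      moreover have "eventually (\<lambda>w. F w = f w) (nhds z)"
        using eventually_nhds_in_open[OF open_halfspace_Im_gt[of 0], of z] 1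
        by (auto elim!: eventually_mono simp: F_def)
      ultimately show ?thesis by (simp cong: isCont_cong)
    next
      case 2
      have "isCont h z"
        using holomorphic_on_imp_continuous_on[OF hh] 2
        by (simp add: continuous_on_eq_continuous_at open_halfspace_Im_lt)
      moreover have "eventually (\<lambda>w. F w = h w) (nhds z)"
        using eventually_nhds_in_open[OF open_halfspace_Im_lt[of 0], of z] 2
        by (auto elim!: eventually_mono simp: F_def)
      ultimately show ?thesis by (simp cong: isCont_cong)
    next
      case 3
      define x where "x = Re z"
      have x: "x \<in> I" "z = of_real x" using real_U[OF z 3] by (auto simp: x_def)
      have up: "(F \<longlongrightarrow> p x) (at z within {z. Im z > 0})"
        by (rule Lim_transform_eventually[of f])
           (use lf x in \<open>auto simp: I_def eventually_at_filter F_def\<close>)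
      have low: "(F \<longlongrightarrow> p x) (at z within {z. Im z < 0})"
        by (rule Lim_transform_eventually[of h])
           (use lh x in \<open>auto simp: I_def eventually_at_filter F_def\<close>)
      have "isCont p x" using p_cont x opens by (simp add: continuous_on_eq_continuous_at)
      moreover have "(Re \<longlongrightarrow> x) (at z within {z. Im z = 0})"
        unfolding x_def by (intro tendsto_intros)
      ultimately have "((\<lambda>w. p (Re w)) \<longlongrightarrow> p x) (at z within {z. Im z = 0})"
        by (rule isCont_tendsto_compose)
      then have mid: "(F \<longlongrightarrow> p x) (at z within {z. Im z = 0})"
        by (rule Lim_transform_eventually) (auto simp: eventually_at_filter F_def)
      have "UNIV = {z. Im z > 0} \<union> {z. Im z < 0} \<union> {z. Im z = 0}" by auto
      then have "(F \<longlongrightarrow> p x) (at z)" using up low mid by (metis Lim_Un)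
      then show ?thesis using 3 by (simp add: isCont_def F_def x_def)
    qed
  qed
  \<comment> \<open>The inner product with \<open>\<i>\<close> is the imaginary part, so the line of pasting is the real axis.\<close>
  have F_hol: "F holomorphic_on U"
  proof (rule holomorphic_on_paste_across_line[OF opens(2), of \<i> F 0])
    have "h holomorphic_on U \<inter> {z. \<i> \<bullet> z < 0}"
      by (rule holomorphic_on_subset[OF hh]) (auto simp: inner_complex_def)
    then show "F holomorphic_on U \<inter> {z. \<i> \<bullet> z < 0}"
      by (rule holomorphic_transform) (auto simp: inner_complex_def F_def)
    have "f holomorphic_on U \<inter> {z. 0 < \<i> \<bullet> z}"
      by (rule holomorphic_on_subset[OF hf]) (auto simp: inner_complex_def)
    then show "F holomorphic_on U \<inter> {z. 0 < \<i> \<bullet> z}"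
      by (rule holomorphic_transform) (auto simp: inner_complex_def F_def)
  qed (use F_cont in auto)
  obtain e1 where e1: "e1 > 0" "\<And>z. Im z > 0 \<Longrightarrow> dist z (of_real x0) < e1 \<Longrightarrow> norm (f z) \<le> C"
    using bf unfolding eventually_at by (force simp: complex_eq_iff)
  obtain e2 where e2: "e2 > 0" "\<And>z. Im z < 0 \<Longrightarrow> dist z (of_real x0) < e2 \<Longrightarrow> norm (h z) \<le> C"
    using bh unfolding eventually_at by (force simp: complex_eq_iff)
  define e where "e = min d (min e1 e2)"
  \<comment> \<open>On the real axis the bound is inherited by the limit from above.\<close>
  have "norm (F z) \<le> C" if z: "z \<in> ball (of_real x0) e - {of_real x0}" for z
  proof -
    consider "Im z > 0" | "Im z < 0" | "Im z = 0" by linarith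
    then show ?thesis
    proof cases
      case 3
      have zU: "z \<in> U" using z by (auto simp: U_def e_def)
      note x = real_U[OF zU 3]
      have "eventually (\<lambda>w. norm (f w) \<le> C) (at z within {z. Im z > 0})"
        unfolding eventually_at_topological
        by (intro exI[of _ "ball (of_real x0) e"]) (use z e1 in \<open>auto simp: e_def dist_commute\<close>)
      moreover have "(f \<longlongrightarrow> p (Re z)) (at z within {z. Im z > 0})"
        using lf[of "Re z"] x by (auto simp: I_def)
      moreover have "at z within {z. Im z > 0} \<noteq> bot"
        using half_planes_nontrivial(1)[of "Re z"] x by simp
      ultimately have "norm (p (Re z)) \<le> C"
        using Lim_norm_ubound by blast
      then show ?thesis using 3 by (simp add: F_def)
    qed (use z e1 e2 in \<open>auto simp: F_def e_def dist_commute\<close>)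
  qed
  moreover have "e > 0" using d e1 e2 by (simp add: e_def)
  ultimately have "F \<in> O[at (of_real x0)](\<lambda>_. 1)"
    by (intro bigoI[of _ C]) (auto simp: eventually_at dist_commute intro!: exI[of _ e])
  then obtain G where G: "G holomorphic_on ball (of_real x0) d"
    "\<And>z. z \<in> ball (of_real x0) d - {of_real x0} \<Longrightarrow> G z = F z"
    using holomorphic_on_extend[of F "ball (of_real x0) d" "of_real x0"] F_hol d
    unfolding U_def by auto
  have "isCont G (of_real x0)"
    using holomorphic_on_imp_continuous_on[OF G(1)] d by (simp add: continuous_on_eq_continuous_at)
  then have G_lim: "(G \<longlongrightarrow> G (of_real x0)) (at (of_real x0) within S)" for S
    unfolding isCont_def by (rule tendsto_within_subset) auto
  have GF: "eventually (\<lambda>z. G z = F z) (at (of_real x0) within S)" for S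
    unfolding eventually_at_topological
    by (intro exI[of _ "ball (of_real x0) d"]) (use G(2) d in auto)
  have Ff: "eventually (\<lambda>z. F z = f z) (at_above x0)"
    and Fh: "eventually (\<lambda>z. F z = h z) (at_below x0)"
    by (auto simp: eventually_at_filter F_def)
  show ?thesis
    using Lim_transform_eventually[OF Lim_transform_eventually[OF G_lim GF] Ff]
          Lim_transform_eventually[OF Lim_transform_eventually[OF G_lim GF] Fh] by blast
qed

lemma tendsto_matrix_mult [tendsto_intros]:
  fixes A :: "_ \<Rightarrow> complex^'n^'m" and B :: "_ \<Rightarrow> complex^'k^'n"
  assumes "(A \<longlongrightarrow> A0) F" "(B \<longlongrightarrow> B0) F"
  shows "((\<lambda>z. A z ** B z) \<longlongrightarrow> A0 ** B0) F"
  unfolding matrix_matrix_mult_def by (intro tendsto_intros assms)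

text \<open>Multiplication of \<open>M\<close> by \<open>A\<close> in the lower half plane turns the jump into continuity, so the
  scalar lemma applies to each entry.  Invertibility of \<open>A\<close> recovers the limit of \<open>M\<close> itself from below.\<close>
lemma matrix_limits_at_removable_point:
  fixes M :: "complex \<Rightarrow> complex^'n^'n"
  assumes d: "0 < d"
    and hol: "matrix_holomorphic_on M {z. Im z \<noteq> 0}"
    and AB: "A ** B = mat 1"
    and up: "\<And>x. x \<in> {x0 - d<..<x0 + d} - {x0} \<Longrightarrow> (M \<longlongrightarrow> Q x ** A) (at_above x)"
    and low: "\<And>x. x \<in> {x0 - d<..<x0 + d} - {x0} \<Longrightarrow> (M \<longlongrightarrow> Q x) (at_below x)"
    and bdd: "(\<lambda>z. norm (M z)) \<in> O[at (of_real x0) within {z. Im z \<noteq> 0}](\<lambda>_. 1)"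
  shows "has_jump M A x0"
proof -
  obtain C where C: "C > 0" "eventually (\<lambda>z. norm (M z) \<le> C) (at (of_real x0) within {z. Im z \<noteq> 0})"
    using bdd by (auto elim!: landau_o.bigE)
  have ent: "norm (M z $ i $ j) \<le> norm (M z)" for z i j
    by (rule order_trans[OF Finite_Cartesian_Product.norm_nth_le Finite_Cartesian_Product.norm_nth_le])
  have hol': "(\<lambda>z. M z $ i $ j) holomorphic_on S" if "S \<subseteq> {z. Im z \<noteq> 0}" for i j S
    using hol that by (auto simp: matrix_holomorphic_on_def intro: holomorphic_on_subset)
  have "\<exists>L. ((\<lambda>z. M z $ i $ j) \<longlongrightarrow> L) (at_above x0) \<and>
             ((\<lambda>z. (M z ** A) $ i $ j) \<longlongrightarrow> L) (at_below x0)" for i j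
  proof (rule limits_at_removable_point[OF d, where p = "\<lambda>x. (Q x ** A) $ i $ j"])
    \<comment> \<open>one constant that bounds an entry of \<open>M\<close> as well as one of \<open>M ** A\<close>\<close>
    define D where "D = C + (\<Sum>k\<in>UNIV. C * norm (A $ k $ j))"
    have D: "C \<le> D" using C unfolding D_def by (auto intro!: sum_nonneg)
    show "(\<lambda>z. M z $ i $ j) holomorphic_on {z. Im z > 0}" by (intro hol') auto
    show "(\<lambda>z. (M z ** A) $ i $ j) holomorphic_on {z. Im z < 0}"
      unfolding matrix_matrix_mult_def vec_lambda_beta by (intro holomorphic_intros hol') auto
    show "((\<lambda>z. M z $ i $ j) \<longlongrightarrow> (Q x ** A) $ i $ j) (at_above x)"
      if "x \<in> {x0 - d<..<x0 + d} - {x0}" for x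
      by (intro tendsto_intros up that)
    show "((\<lambda>z. (M z ** A) $ i $ j) \<longlongrightarrow> (Q x ** A) $ i $ j) (at_below x)"
      if "x \<in> {x0 - d<..<x0 + d} - {x0}" for x
      by (intro tendsto_intros low that)
    show "eventually (\<lambda>z. norm (M z $ i $ j) \<le> D) (at_above x0)"
    proof -
      have "eventually (\<lambda>z. norm (M z) \<le> C) (at_above x0)"
        using C(2) by (rule filter_leD[OF at_le, rotated]) auto
      then show ?thesis by eventually_elim (use ent D in \<open>meson order_trans\<close>)
    qed
    show "eventually (\<lambda>z. norm ((M z ** A) $ i $ j) \<le> D) (at_below x0)"
    proof -
      have "eventually (\<lambda>z. norm (M z) \<le> C) (at_below x0)"
        using C(2) by (rule filter_leD[OF at_le, rotated]) auto
      then show ?thesis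
      proof eventually_elim
        case (elim z)
        have "norm ((M z ** A) $ i $ j) \<le> (\<Sum>k\<in>UNIV. norm (M z $ i $ k) * norm (A $ k $ j))"
          unfolding matrix_matrix_mult_def by (simp add: norm_mult[symmetric] norm_sum)
        also have "\<dots> \<le> (\<Sum>k\<in>UNIV. C * norm (A $ k $ j))"
          by (intro sum_mono mult_right_mono) (use ent elim in \<open>auto intro: order_trans\<close>)
        also have "\<dots> \<le> D" using C by (simp add: D_def)
        finally show ?case .
      qed
    qed
  qed
  then obtain P where P:
    "\<And>i j. ((\<lambda>z. M z $ i $ j) \<longlongrightarrow> P i j) (at_above x0)"
    "\<And>i j. ((\<lambda>z. (M z ** A) $ i $ j) \<longlongrightarrow> P i j) (at_below x0)"
    by metis
  define R where "R = (\<chi> i j. P i j)"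
  have R1: "(M \<longlongrightarrow> R) (at_above x0)"
    by (intro vec_tendstoI) (simp add: R_def P)
  have R2: "((\<lambda>z. M z ** A) \<longlongrightarrow> R) (at_below x0)"
    by (intro vec_tendstoI) (simp add: R_def P)
  have "((\<lambda>z. M z ** A ** B) \<longlongrightarrow> R ** B) (at_below x0)"
    by (intro tendsto_intros R2)
  then have "(M \<longlongrightarrow> R ** B) (at_below x0)"
    by (simp add: matrix_mul_assoc[symmetric] AB)
  moreover have "R ** B ** A = R"
    using AB matrix_left_right_inverse[of A B] by (simp add: matrix_mul_assoc[symmetric])
  ultimately show ?thesis using R1 by metis
qed

section \<open>Boundary behaviour of the scalar functions\<close>

text \<open>Write \<open>w\<close> for the radicand.  Then \<open>- w\<close> is positive at \<open>x\<close>, so the principal root of \<open>- w\<close> is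
  continuous there.  The imaginary parts of \<open>w\<close> and \<open>z\<close> have the same sign, and thus the root of \<open>w\<close> differs from
  that of \<open>- w\<close> by the phase \<open>exp (\<plusminus>\<i>\<pi>/4)\<close>; the two phases have quotient \<open>\<i>\<close>.\<close>
lemma root_factor_cut_limits:
  assumes "p < x" "x < q"
  shows "\<exists>B. B \<noteq> 0 \<and> (root_factor p q \<longlongrightarrow> \<i> * B) (at_above x) \<and>
    (root_factor p q \<longlongrightarrow> B) (at_below x)"
proof -
  define w where "w z = (z - complex_of_real q) / (z - complex_of_real p)" for z
  define R where "R = (- w (of_real x)) powr (1/4)"
  have wx: "- w (of_real x) = of_real ((q - x) / (x - p))"
    using assms by (simp add: w_def field_simps)
  have pos: "(q - x) / (x - p) > 0" using assms by simp
  have off: "- w (of_real x) \<notin> \<real>\<^sub>\<le>\<^sub>0"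
    unfolding wx nonpos_Reals_of_real_iff using pos by simp
  have lim: "((\<lambda>z. (- w z) powr (1/4)) \<longlongrightarrow> R) (at (of_real x) within S)" for S
    unfolding R_def using off assms
    by (intro tendsto_powr_complex) (auto simp: w_def intro!: tendsto_intros)
  have Im_w: "Im (w z) = (q - p) * Im z / (norm (z - of_real p))\<^sup>2" if "Im z \<noteq> 0" for z
    by (simp add: w_def Im_divide cmod_power2 algebra_simps diff_divide_distrib[symmetric])
  have up: "root_factor p q z = exp (\<i> * pi / 4) * (- w z) powr (1/4)" if "Im z > 0" for z
  proof -
    have "Im (w z) > 0" unfolding Im_w[OF less_imp_neq[OF that, symmetric]]
      using that assms by (intro divide_pos_pos mult_pos_pos) (auto simp: complex_eq_iff)
    moreover from this have "w z \<noteq> 0" by auto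
    ultimately have "w z \<noteq> 0" "Ln (- w z) = Ln (w z) - \<i> * pi" using Ln_minus[of "w z"] by simp_all
    then show ?thesis
      by (simp add: root_factor_def powr_def flip: w_def exp_add) (simp add: field_simps)
  qed
  have low: "root_factor p q z = exp (- (\<i> * pi / 4)) * (- w z) powr (1/4)" if "Im z < 0" for z
  proof -
    have "Im (w z) < 0" unfolding Im_w[OF less_imp_neq[OF that]]
      using that assms by (intro divide_neg_pos mult_pos_neg) (auto simp: complex_eq_iff)
    moreover from this have "w z \<noteq> 0" by auto
    ultimately have "w z \<noteq> 0" "Ln (- w z) = Ln (w z) + \<i> * pi" using Ln_minus[of "w z"] by simp_all
    then show ?thesis
      by (simp add: root_factor_def powr_def flip: w_def exp_add) (simp add: field_simps)
  qed
  have "((\<lambda>z. exp (\<i> * pi / 4) * (- w z) powr (1/4)) \<longlongrightarrow> exp (\<i> * pi / 4) * R) (at_above x)"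
    by (intro tendsto_intros lim)
  then have 1: "(root_factor p q \<longlongrightarrow> exp (\<i> * pi / 4) * R) (at_above x)"
    by (rule Lim_transform_eventually) (auto simp: eventually_at_filter up)
  have "((\<lambda>z. exp (- (\<i> * pi / 4)) * (- w z) powr (1/4)) \<longlongrightarrow> exp (- (\<i> * pi / 4)) * R) (at_below x)"
    by (intro tendsto_intros lim)
  then have 2: "(root_factor p q \<longlongrightarrow> exp (- (\<i> * pi / 4)) * R) (at_below x)"
    by (rule Lim_transform_eventually) (auto simp: eventually_at_filter low)
  have "exp (\<i> * pi / 4) = exp (\<i> * pi / 2) * exp (- (\<i> * pi / 4))"
    by (simp flip: exp_add)
  also have "exp (\<i> * pi / 2) = \<i>"
    by (metis cis_conv_exp cis_pi_half of_real_divide of_real_numeral times_divide_eq_right)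
  finally have "exp (\<i> * pi / 4) * R = \<i> * (exp (- (\<i> * pi / 4)) * R)" by simp
  moreover have "R \<noteq> 0" using off by (auto simp: R_def)
  ultimately show ?thesis
    using 1 2 by (intro exI[of _ "exp (- (\<i> * pi / 4)) * R"]) (auto simp: mult.assoc)
qed

lemma beta_split:
  assumes "k \<le> g"
  shows "beta g a b z = root_factor (a k) (b k) z * (\<Prod>\<nu>\<in>{..g} - {k}. root_factor (a \<nu>) (b \<nu>) z)"
  unfolding beta_eq_prod using assms by (intro prod.remove) auto

lemma isCont_imp_tendsto_within:
  "isCont f x \<Longrightarrow> (f \<longlongrightarrow> f x) (at x within T)"
  using continuous_at_imp_continuous_at_within continuous_within by blast

text \<open>At a point of the closed band \<open>k\<close> all the remaining factors of \<open>\<beta>\<close> are holomorphic and nonzero.  Therefore only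
  factor \<open>k\<close> matters for the jump on the cut and for the growth at its endpoints.\<close>
lemma other_factors_limit:
  assumes il: "interlaced g a b" and k: "k \<le> g" and x: "x \<in> {a k..b k}"
  obtains R where "R \<noteq> 0"
    "\<And>S. ((\<lambda>z. \<Prod>\<nu>\<in>{..g} - {k}. root_factor (a \<nu>) (b \<nu>) z) \<longlongrightarrow> R) (at (of_real x) within S)"
proof -
  let ?R = "\<lambda>z. \<Prod>\<nu>\<in>{..g} - {k}. root_factor (a \<nu>) (b \<nu>) z"
  have off: "complex_of_real x \<notin> complex_of_real ` {a \<nu>..b \<nu>}" if "\<nu> \<in> {..g} - {k}" for \<nu>
    using interlaced_bands_disjoint[OF il k, of \<nu> x] x that by auto
  have "isCont (root_factor (a \<nu>) (b \<nu>)) (of_real x)" if "\<nu> \<in> {..g} - {k}" for \<nu>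
  proof -
    have "open (- complex_of_real ` {a \<nu>..b \<nu>})"
      by (intro open_Compl compact_imp_closed compact_continuous_image) (auto intro: continuous_intros)
    then show ?thesis
      using holomorphic_on_imp_continuous_on[OF root_factor_holomorphic[OF interlaced_less[OF il, of \<nu>]]]
        off[OF that] that by (auto simp: continuous_on_eq_continuous_at)
  qed
  then have "isCont ?R (of_real x)" by (intro continuous_prod)
  then have "(?R \<longlongrightarrow> ?R (of_real x)) (at (of_real x) within S)" for S
    by (rule isCont_imp_tendsto_within)
  moreover have "?R (of_real x) \<noteq> 0"
    using off root_factor_nonzero interlaced_less[OF il] by auto
  ultimately show ?thesis using that by blast
qed

text \<open>Inserting \<open>\<beta>\<^sub>+ = \<i>\<beta>\<^sub>-\<close> into the definitions gives \<open>c\<^sub>+ = -s\<^sub>-\<close> and \<open>s\<^sub>+ = c\<^sub>-\<close>; here \<open>C\<close> and \<open>S\<close> are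
  the limits of \<open>c\<close> and \<open>s\<close> from below.\<close>
lemma c_s_cut_limits:
  assumes il: "interlaced g a b" and k: "k \<le> g" and x: "x \<in> cut a b k"
  obtains C S where
    "(c_fun g a b \<longlongrightarrow> - S) (at_above x)"
    "(s_fun g a b \<longlongrightarrow> C) (at_above x)"
    "(c_fun g a b \<longlongrightarrow> C) (at_below x)"
    "(s_fun g a b \<longlongrightarrow> S) (at_below x)"
proof -
  have x': "a k < x" "x < b k" using x by (auto simp: cut_def)
  obtain B where B: "B \<noteq> 0"
    "(root_factor (a k) (b k) \<longlongrightarrow> \<i> * B) (at_above x)"
    "(root_factor (a k) (b k) \<longlongrightarrow> B) (at_below x)"
    using root_factor_cut_limits[OF x'] by blast
  obtain R where R: "R \<noteq> 0"
    "\<And>S. ((\<lambda>z. \<Prod>\<nu>\<in>{..g} - {k}. root_factor (a \<nu>) (b \<nu>) z) \<longlongrightarrow> R) (at (of_real x) within S)"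
    using other_factors_limit[OF il k, of x] x' by auto
  define b0 where "b0 = B * R"
  have b0: "b0 \<noteq> 0" using B R by (simp add: b0_def)
  have up: "(beta g a b \<longlongrightarrow> \<i> * b0) (at_above x)"
    unfolding beta_split[OF k] b0_def mult.assoc[symmetric] by (intro tendsto_mult B R)
  have low: "(beta g a b \<longlongrightarrow> b0) (at_below x)"
    unfolding beta_split[OF k] b0_def by (intro tendsto_mult B R)
  define C where "C = (b0 + inverse b0) / 2"
  define S where "S = (b0 - inverse b0) / (2 * \<i>)"
  have eqs: "- S = (\<i> * b0 + inverse (\<i> * b0)) / 2" "C = (\<i> * b0 - inverse (\<i> * b0)) / (2 * \<i>)"
    using b0 by (simp_all add: S_def C_def field_simps)
  show ?thesis
  proof (rule that[of S C])
    show "(c_fun g a b \<longlongrightarrow> - S) (at_above x)"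
      unfolding c_fun_def eqs using b0 by (intro tendsto_intros up) auto
    show "(s_fun g a b \<longlongrightarrow> C) (at_above x)"
      unfolding s_fun_def eqs using b0 by (intro tendsto_intros up) auto
    show "(c_fun g a b \<longlongrightarrow> C) (at_below x)"
      unfolding c_fun_def C_def using b0 by (intro tendsto_intros low) auto
    show "(s_fun g a b \<longlongrightarrow> S) (at_below x)"
      unfolding s_fun_def S_def using b0 by (intro tendsto_intros low) auto
  qed
qed

lemma norm_root_factor:
  "norm (root_factor p q z) = norm (z - of_real q) powr (1/4) * inverse (norm (z - of_real p) powr (1/4))"
proof -
  have "norm (root_factor p q z) = norm ((z - of_real q) / (z - of_real p)) powr (1/4)"
    using norm_powr_real_powr'[of "1/4" "(z - of_real q) / (z - of_real p)"]
    by (simp add: root_factor_def)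
  then show ?thesis
    by (simp only: norm_divide powr_divide norm_ge_zero divide_inverse[of "_ powr _"])
qed

text \<open>Both the modulus of a factor of \<open>\<beta>\<close> and that of its inverse have the form of one of these two ratios.  One
  ratio vanishes at \<open>e\<close> and the other grows like the power \<open>-1/4\<close>, which serves as a bound for both
  and thus treats the two ends of a band alike.\<close>
lemma endpoint_ratio_bigo:
  fixes e f :: complex
  assumes "e \<noteq> f"
  shows "(\<lambda>z. norm (z - e) powr (1/4) * inverse (norm (z - f) powr (1/4)))
           \<in> O[at e within T](\<lambda>z. norm (z - e) powr (- 1/4))"
    and "(\<lambda>z. norm (z - f) powr (1/4) * inverse (norm (z - e) powr (1/4)))
           \<in> O[at e within T](\<lambda>z. norm (z - e) powr (- 1/4))"
proof -
  have nz: "eventually (\<lambda>z. norm (z - e) powr (- 1/4) \<noteq> 0) (at e within T)"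
    by (auto simp: eventually_at_filter)
  have e0: "((\<lambda>z. norm (z - e)) \<longlongrightarrow> 0) (at e within T)"
    by (auto intro!: tendsto_eq_intros)
  \<comment> \<open>Division by the power \<open>-1/4\<close> raises the exponent \<open>1/4\<close> to \<open>1/2\<close>.\<close>
  have "((\<lambda>z. norm (z - e) powr (1/2) * inverse (norm (z - f) powr (1/4))) \<longlongrightarrow>
      0 * inverse (norm (e - f) powr (1/4))) (at e within T)"
    using assms by (intro tendsto_intros tendsto_zero_powrI[OF e0]) auto
  then have "((\<lambda>z. (norm (z - e) powr (1/4) * inverse (norm (z - f) powr (1/4))) / norm (z - e) powr (- 1/4)) \<longlongrightarrow>
      0 * inverse (norm (e - f) powr (1/4))) (at e within T)"
    by (rule Lim_transform_eventually)
       (auto simp: eventually_at_filter powr_minus_divide powr_add[symmetric] field_simps)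
  from bigoI_tendsto[OF this nz] show "(\<lambda>z. norm (z - e) powr (1/4) * inverse (norm (z - f) powr (1/4)))
           \<in> O[at e within T](\<lambda>z. norm (z - e) powr (- 1/4))" .
  have "((\<lambda>z. norm (z - f) powr (1/4)) \<longlongrightarrow> norm (e - f) powr (1/4)) (at e within T)"
    using assms by (intro tendsto_intros) auto
  then have "((\<lambda>z. (norm (z - f) powr (1/4) * inverse (norm (z - e) powr (1/4))) / norm (z - e) powr (- 1/4)) \<longlongrightarrow>
      norm (e - f) powr (1/4)) (at e within T)"
    by (rule Lim_transform_eventually)
       (auto simp: eventually_at_filter powr_minus_divide field_simps)
  from bigoI_tendsto[OF this nz] show "(\<lambda>z. norm (z - f) powr (1/4) * inverse (norm (z - e) powr (1/4)))
           \<in> O[at e within T](\<lambda>z. norm (z - e) powr (- 1/4))" .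
qed

lemma beta_endpoint_growth:
  assumes il: "interlaced g a b" and e: "e \<in> endpoints g a b"
  shows "(\<lambda>z. norm (beta g a b z)) \<in> O[at (of_real e) within T](\<lambda>z. norm (z - of_real e) powr (- 1/4))" (is ?A)
    and "(\<lambda>z. norm (inverse (beta g a b z))) \<in> O[at (of_real e) within T](\<lambda>z. norm (z - of_real e) powr (- 1/4))" (is ?B)
proof -
  obtain k where k: "k \<le> g" "e = a k \<or> e = b k" using e by (auto simp: endpoints_def)
  have ab: "a k < b k" using interlaced_less[OF il k(1)] .
  let ?R = "\<lambda>z. \<Prod>\<nu>\<in>{..g} - {k}. root_factor (a \<nu>) (b \<nu>) z"
  have "e \<in> {a k..b k}" using k ab by auto
  then obtain R where R: "R \<noteq> 0" "\<And>S. (?R \<longlongrightarrow> R) (at (of_real e) within S)"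
    using other_factors_limit[OF il k(1), of e] by metis
  have R1: "(\<lambda>z. norm (?R z)) \<in> O[at (of_real e) within T](\<lambda>_. 1)"
    by (rule bigoI_tendsto[of _ _ "norm R"]) (use tendsto_norm[OF R(2)] in auto)
  have R2: "(\<lambda>z. norm (inverse (?R z))) \<in> O[at (of_real e) within T](\<lambda>_. 1)"
    by (rule bigoI_tendsto[of _ _ "norm (inverse R)"]) (use tendsto_norm[OF tendsto_inverse[OF R(2,1)]] in auto)
  have "(\<lambda>z. norm (root_factor (a k) (b k) z)) \<in> O[at (of_real e) within T](\<lambda>z. norm (z - of_real e) powr (- 1/4))"
       "(\<lambda>z. norm (inverse (root_factor (a k) (b k) z))) \<in> O[at (of_real e) within T](\<lambda>z. norm (z - of_real e) powr (- 1/4))"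
    unfolding norm_root_factor norm_inverse inverse_mult_distrib inverse_inverse_eq
    using k(2) ab endpoint_ratio_bigo[of "complex_of_real (a k)" "complex_of_real (b k)" T]
      endpoint_ratio_bigo[of "complex_of_real (b k)" "complex_of_real (a k)" T]
    by (auto simp: mult.commute)
  from landau_o.big.mult[OF this(1) R1] landau_o.big.mult[OF this(2) R2]
  show ?A ?B
    unfolding beta_split[OF k(1)] by (simp_all only: norm_mult inverse_mult_distrib mult_1_right)
qed

lemma c_s_endpoint_growth:
  assumes "interlaced g a b" "e \<in> endpoints g a b"
  shows "(\<lambda>z. norm (c_fun g a b z)) \<in> O[at (of_real e) within T](\<lambda>z. norm (z - of_real e) powr (- 1/4))"
    and "(\<lambda>z. norm (s_fun g a b z)) \<in> O[at (of_real e) within T](\<lambda>z. norm (z - of_real e) powr (- 1/4))"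
proof -
  have *: "(\<lambda>z. norm (beta g a b z) + norm (inverse (beta g a b z)))
      \<in> O[at (of_real e) within T](\<lambda>z. norm (z - of_real e) powr (- 1/4))"
    by (intro sum_in_bigo beta_endpoint_growth assms)
  have "norm (c_fun g a b z) \<le> norm (beta g a b z) + norm (inverse (beta g a b z))" for z
    using norm_triangle_ineq[of "beta g a b z" "inverse (beta g a b z)"]
      norm_ge_zero[of "beta g a b z"] norm_ge_zero[of "inverse (beta g a b z)"]
    unfolding c_fun_def norm_divide norm_numeral by linarith
  then show "(\<lambda>z. norm (c_fun g a b z)) \<in> O[at (of_real e) within T](\<lambda>z. norm (z - of_real e) powr (- 1/4))"
    by (intro landau_o.big_trans[OF bigoI[of _ 1] *]) auto
  have "norm (s_fun g a b z) \<le> norm (beta g a b z) + norm (inverse (beta g a b z))" for z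
    using norm_triangle_ineq4[of "beta g a b z" "inverse (beta g a b z)"]
      norm_ge_zero[of "beta g a b z"] norm_ge_zero[of "inverse (beta g a b z)"]
    unfolding s_fun_def norm_divide norm_mult norm_numeral norm_ii mult_1_right by linarith
  then show "(\<lambda>z. norm (s_fun g a b z)) \<in> O[at (of_real e) within T](\<lambda>z. norm (z - of_real e) powr (- 1/4))"
    by (intro landau_o.big_trans[OF bigoI[of _ 1] *]) auto
qed

text \<open>The difference quotient of \<open>h\<close> at 0, read in the coordinate \<open>z = 1/w\<close>, is \<open>z (f z - h 0)\<close>; its
  convergence bounds it near \<open>\<infinity>\<close>.\<close>
lemma expansion_at_infinity:
  fixes f h :: "complex \<Rightarrow> complex"
  assumes "h field_differentiable at 0" "eventually (\<lambda>w. h w = f (inverse w)) (at 0)"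
  shows "(\<lambda>z. norm (f z - h 0)) \<in> O[at_infinity](\<lambda>z. 1 / norm z)"
proof -
  obtain D where "(h has_field_derivative D) (at 0)"
    using assms(1) by (auto simp: field_differentiable_def)
  then have "((\<lambda>w. (h w - h 0) / w) \<longlongrightarrow> D) (at 0)"
    by (simp add: has_field_derivative_iff)
  then have "((\<lambda>w. (f (inverse w) - h 0) / w) \<longlongrightarrow> D) (at 0)"
    by (rule Lim_transform_eventually) (use assms(2) in \<open>auto elim!: eventually_mono\<close>)
  then have "((\<lambda>z. (f z - h 0) / inverse z) \<longlongrightarrow> D) at_infinity"
    unfolding at_to_infinity filterlim_filtermap by simp
  from tendsto_norm[OF this]
  have "((\<lambda>z. norm (f z - h 0) / (1 / norm z)) \<longlongrightarrow> norm D) at_infinity"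
    by (simp add: norm_divide norm_inverse norm_mult divide_inverse)
  then show ?thesis
    by (rule bigoI_tendsto)
       (auto simp: eventually_at_infinity intro!: exI[of _ 1])
qed

lemma c_s_at_infinity:
  shows "(\<lambda>z. norm (c_fun g a b z - 1)) \<in> O[at_infinity](\<lambda>z. 1 / norm z)"
    and "(\<lambda>z. norm (s_fun g a b z)) \<in> O[at_infinity](\<lambda>z. 1 / norm z)"
proof -
  \<comment> \<open>\<open>\<beta>\<close> in the coordinate \<open>w = 1/z\<close>, with numerators and denominators multiplied by \<open>w\<close>\<close>
  define h where "h w = (\<Prod>\<nu>\<le>g. ((1 - of_real (b \<nu>) * w) / (1 - of_real (a \<nu>) * w)) powr (1/4))" for w :: complex
  have h0: "h 0 = 1" by (simp add: h_def)
  have h_diff: "h field_differentiable at 0"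
  proof -
    have "h analytic_on {0}" unfolding h_def
      by (intro analytic_intros) auto
    then show ?thesis by (simp add: analytic_on_imp_differentiable_at)
  qed
  have hb: "h w = beta g a b (inverse w)" if "w \<noteq> 0" for w
    unfolding h_def beta_def
  proof (intro prod.cong refl)
    fix \<nu>
    have "inverse w - of_real t = (1 - of_real t * w) / w" for t
      using that by (simp add: field_simps)
    then show "((1 - of_real (b \<nu>) * w) / (1 - of_real (a \<nu>) * w)) powr (1/4) =
        ((inverse w - of_real (b \<nu>)) / (inverse w - of_real (a \<nu>))) powr (1/4)"
      using that by simp
  qed
  have "(\<lambda>w. (h w + inverse (h w)) / 2) field_differentiable at 0"
       "(\<lambda>w. (h w - inverse (h w)) / (2 * \<i>)) field_differentiable at 0"
    using h_diff h0 by (auto intro!: derivative_intros)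
  from this[THEN expansion_at_infinity, of "c_fun g a b"] this[THEN expansion_at_infinity, of "s_fun g a b"]
  show "(\<lambda>z. norm (c_fun g a b z - 1)) \<in> O[at_infinity](\<lambda>z. 1 / norm z)"
       "(\<lambda>z. norm (s_fun g a b z)) \<in> O[at_infinity](\<lambda>z. 1 / norm z)"
    by (simp_all add: c_fun_def s_fun_def hb h0 eventually_at_filter)
qed

text \<open>\<open>s\<close> is differentiable at \<open>\<xi>\<^sub>j\<close> and vanishes there, because \<open>\<beta> = 1\<close>.  This zero compensates the pole that the
  normalisation admits.\<close>
lemma s_fun_xi_bigo:
  assumes il: "interlaced g a b" and j: "j \<in> {1..g}"
  shows "(\<lambda>z. norm (s_fun g a b z)) \<in> O[at (of_real (xi g a b j)) within T](\<lambda>z. norm (z - of_real (xi g a b j)))"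
proof -
  let ?x = "complex_of_real (xi g a b j)"
  have off: "?x \<in> - bands g a b" using gap_off_bands[OF il j xi_props(1)[OF il j]] by simp
  have "s_fun g a b field_differentiable at ?x"
    using s_fun_holomorphic[OF il] off closed_bands[of g a b]
    by (auto simp: holomorphic_on_open open_Compl field_differentiable_def)
  then obtain D where "(s_fun g a b has_field_derivative D) (at ?x)"
    by (auto simp: field_differentiable_def)
  moreover have "s_fun g a b ?x = 0" using beta_at_xi[OF il j] by (simp add: s_fun_def)
  ultimately have "((\<lambda>z. s_fun g a b z / (z - ?x)) \<longlongrightarrow> D) (at ?x)"
    by (simp add: has_field_derivative_iff)
  then have "((\<lambda>z. s_fun g a b z / (z - ?x)) \<longlongrightarrow> D) (at ?x within T)"
    by (rule tendsto_within_subset) auto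
  from tendsto_norm[OF this]
  have "((\<lambda>z. norm (s_fun g a b z) / norm (z - ?x)) \<longlongrightarrow> norm D) (at ?x within T)"
    by (simp add: norm_divide)
  then show ?thesis
    by (rule bigoI_tendsto) (auto simp: eventually_at_filter)
qed

lemma c_s_gap_limits:
  assumes il: "interlaced g a b" and j: "j \<in> {1..g}" and x: "x \<in> gap a b j"
  shows "(c_fun g a b \<longlongrightarrow> c_fun g a b (of_real x)) (at (of_real x) within T)"
    and "(s_fun g a b \<longlongrightarrow> s_fun g a b (of_real x)) (at (of_real x) within T)"
proof -
  have "isCont (c_fun g a b) (of_real x)" "isCont (s_fun g a b) (of_real x)"
    using holomorphic_on_imp_continuous_on[OF c_fun_holomorphic[OF il]]
      holomorphic_on_imp_continuous_on[OF s_fun_holomorphic[OF il]]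
      gap_off_bands[OF il j x] closed_bands[of g a b]
    by (auto simp: continuous_on_eq_continuous_at open_Compl)
  then show "(c_fun g a b \<longlongrightarrow> c_fun g a b (of_real x)) (at (of_real x) within T)"
    "(s_fun g a b \<longlongrightarrow> s_fun g a b (of_real x)) (at (of_real x) within T)"
    by (auto intro: isCont_imp_tendsto_within)
qed

section \<open>Matrices in blocks\<close>

lemma norm_cscale: "norm (cscale k A) = norm k * norm (A :: complex^'n^'m)"
  by (simp add: cscale_def map_matrix_def norm_vec_def norm_mult L2_set_right_distrib)

lemma cscale_mult: "cscale k (A ** B) = cscale k A ** (B :: complex^'n^'m)"
  by (simp add: cscale_def map_matrix_def matrix_matrix_mult_def vec_eq_iff sum_distrib_left mult.assoc)

lemma cscale_minus: "cscale (- k) A = - cscale k A"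
  by (simp add: cscale_def map_matrix_def vec_eq_iff)

lemma cscale_minus_1: "cscale k A - B = cscale (k - 1) A + (A - B)"
  by (simp add: cscale_def map_matrix_def vec_eq_iff algebra_simps)

lemma tendsto_cscale [tendsto_intros]:
  assumes "(f \<longlongrightarrow> k) F" "(A \<longlongrightarrow> L) F"
  shows "((\<lambda>z. cscale (f z) (A z)) \<longlongrightarrow> cscale k L) F"
  unfolding cscale_def map_matrix_def by (intro tendsto_intros assms)

lemma block_matrix_nth [simp]:
  "block_matrix A B C D $ Inl p $ Inl q = A $ p $ q"
  "block_matrix A B C D $ Inl p $ Inr q = B $ p $ q"
  "block_matrix A B C D $ Inr p $ Inl q = C $ p $ q"
  "block_matrix A B C D $ Inr p $ Inr q = D $ p $ q"
  by (simp_all add: block_matrix_def)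

lemma block_matrix_eqI:
  assumes "\<And>p q. M $ Inl p $ Inl q = A $ p $ q" "\<And>p q. M $ Inl p $ Inr q = B $ p $ q"
    "\<And>p q. M $ Inr p $ Inl q = C $ p $ q" "\<And>p q. M $ Inr p $ Inr q = D $ p $ q"
  shows "M = block_matrix A B C D"
  unfolding vec_eq_iff
proof (intro allI)
  fix i j show "M $ i $ j = block_matrix A B C D $ i $ j"
    by (cases i; cases j) (simp_all add: assms)
qed

lemma block_matrix_mult:
  fixes A :: "'a::comm_semiring_1^'n^'n"
  shows "block_matrix A B C D ** block_matrix A' B' C' D' =
     block_matrix (A ** A' + B ** C') (A ** B' + B ** D') (C ** A' + D ** C') (C ** B' + D ** D')"
proof -
  have split: "(\<Sum>k\<in>UNIV. f k) = (\<Sum>p\<in>UNIV. f (Inl p)) + (\<Sum>p\<in>UNIV. f (Inr p))"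
    for f :: "'n + 'n \<Rightarrow> 'a"
    by (subst UNIV_Plus_UNIV[symmetric], subst sum.Plus) auto
  show ?thesis
    by (rule block_matrix_eqI) (simp_all add: matrix_matrix_mult_def split)
qed

lemma mat_1_eq_block: "mat 1 = block_matrix (mat 1) 0 0 (mat 1)"
  by (rule block_matrix_eqI) (simp_all add: mat_def)

lemma block_matrix_diff:
  "block_matrix A B C D - block_matrix A' B' C' D' = block_matrix (A - A') (B - B') (C - C') (D - D')"
  by (rule block_matrix_eqI) simp_all

lemma matrix_mult_simps:
  fixes A :: "complex^'n^'n"
  shows "A ** 0 = 0" "0 ** A = 0" "A ** - B = - (A ** B)"
  by (simp_all add: matrix_matrix_mult_def vec_eq_iff sum_negf)

lemma tendsto_block_matrix [tendsto_intros]: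
  assumes "(A \<longlongrightarrow> A') F" "(B \<longlongrightarrow> B') F" "(C \<longlongrightarrow> C') F" "(D \<longlongrightarrow> D') F"
  shows "((\<lambda>z. block_matrix (A z) (B z) (C z) (D z)) \<longlongrightarrow> block_matrix A' B' C' D') F"
proof (intro vec_tendstoI)
  fix i j show "((\<lambda>z. block_matrix (A z) (B z) (C z) (D z) $ i $ j) \<longlongrightarrow> block_matrix A' B' C' D' $ i $ j) F"
    by (cases i; cases j) (auto intro!: tendsto_intros assms)
qed

text \<open>All norms on a space of matrices are equivalent, so that growth can be estimated entry by entry.\<close>
lemma norm_matrix_bigo_iff:
  fixes M :: "'b \<Rightarrow> complex^'n^'m"
  shows "(\<lambda>z. norm (M z)) \<in> O[F](g) \<longleftrightarrow> (\<forall>i j. (\<lambda>z. norm (M z $ i $ j)) \<in> O[F](g))"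
proof (intro iffI allI)
  fix i j assume "(\<lambda>z. norm (M z)) \<in> O[F](g)"
  then show "(\<lambda>z. norm (M z $ i $ j)) \<in> O[F](g)"
    by (rule landau_o.big_trans[rotated])
       (auto intro!: bigoI[of _ 1] always_eventually
             order_trans[OF Finite_Cartesian_Product.norm_nth_le Finite_Cartesian_Product.norm_nth_le])
next
  assume *: "\<forall>i j. (\<lambda>z. norm (M z $ i $ j)) \<in> O[F](g)"
  have "norm (M z) \<le> (\<Sum>i\<in>UNIV. \<Sum>j\<in>UNIV. norm (M z $ i $ j))" for z
  proof -
    have "norm (M z) \<le> (\<Sum>i\<in>UNIV. norm (M z $ i))"
      by (simp add: norm_vec_def L2_set_le_sum)
    also have "\<dots> \<le> (\<Sum>i\<in>UNIV. \<Sum>j\<in>UNIV. norm (M z $ i $ j))"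
      by (intro sum_mono) (simp add: norm_vec_def L2_set_le_sum)
    finally show ?thesis .
  qed
  then have "(\<lambda>z. norm (M z)) \<in> O[F](\<lambda>z. \<Sum>i\<in>UNIV. \<Sum>j\<in>UNIV. norm (M z $ i $ j))"
    by (intro bigoI[of _ 1] always_eventually) (auto intro: order_trans[OF _ abs_ge_self])
  also have "(\<lambda>z. \<Sum>i\<in>UNIV. \<Sum>j\<in>UNIV. norm (M z $ i $ j)) \<in> O[F](g)"
    by (intro big_sum_in_bigo) (use * in auto)
  finally show "(\<lambda>z. norm (M z)) \<in> O[F](g)" .
qed

lemma block_matrix_bigo:
  fixes A :: "'b \<Rightarrow> complex^'n^'n"
  assumes "(\<lambda>z. norm (A z)) \<in> O[F](g)" "(\<lambda>z. norm (B z)) \<in> O[F](g)"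
    "(\<lambda>z. norm (C z)) \<in> O[F](g)" "(\<lambda>z. norm (D z)) \<in> O[F](g)"
  shows "(\<lambda>z. norm (block_matrix (A z) (B z) (C z) (D z))) \<in> O[F](g)"
  unfolding norm_matrix_bigo_iff
proof (intro allI)
  fix i j show "(\<lambda>z. norm (block_matrix (A z) (B z) (C z) (D z) $ i $ j)) \<in> O[F](g)"
    using assms unfolding norm_matrix_bigo_iff by (cases i; cases j) auto
qed

lemma unitary_inverse:
  assumes "unitary_matrix K"
  shows "K ** matrix_inv K = mat 1" "matrix_inv K ** K = mat 1"
proof -
  have "\<exists>A'. K ** A' = mat 1 \<and> A' ** K = mat 1"
    using assms by (auto simp: unitary_matrix_def)
  then show "K ** matrix_inv K = mat 1" "matrix_inv K ** K = mat 1"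
    unfolding matrix_inv_def by (metis (mono_tags, lifting) someI_ex)+
qed

text \<open>Pointwise one-sided limits suffice for continuous boundary values, by \<open>boundary_limits_continuous\<close>.\<close>
lemma jump_from_limits:
  fixes M :: "complex \<Rightarrow> complex^'n^'n"
  assumes "\<And>x. x \<in> I \<Longrightarrow> has_jump M A x"
  shows "has_continuous_bvs_on M I \<and> (\<forall>x\<in>I. bv_plus M x = bv_minus M x ** A)"
proof
  show "has_continuous_bvs_on M I"
    using assms by (intro has_continuous_bvs_onI) blast+
  show "\<forall>x\<in>I. bv_plus M x = bv_minus M x ** A"
    using assms bv_plus_eqI bv_minus_eqI by metis
qed

lemma has_continuous_bvs_onD:
  assumes "has_continuous_bvs_on F I" "x \<in> I"
  shows "(F \<longlongrightarrow> bv_plus F x) (at_above x)"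
    and "(F \<longlongrightarrow> bv_minus F x) (at_below x)"
  using assms by (auto simp: has_continuous_bvs_on_def)

text \<open>The value at \<open>\<infinity>\<close> of the holomorphic extension is the limit along \<open>at_infinity\<close>, hence \<open>A\<close>, and the expansion
  of each entry in \<open>1/z\<close> starts with the entry of \<open>A\<close>.\<close>
lemma matrix_expansion_at_infinity:
  assumes hol: "matrix_holomorphic_at_infinity H" and lim: "(H \<longlongrightarrow> A) at_infinity"
  shows "(\<lambda>z. norm (H z - A)) \<in> O[at_infinity](\<lambda>z. 1 / norm z)"
  unfolding norm_matrix_bigo_iff
proof (intro allI)
  fix i j
  obtain L where L: "\<And>i j. (\<lambda>w. (if w = 0 then L else H (inverse w)) $ i $ j) analytic_on {0}"
    using hol unfolding matrix_holomorphic_at_infinity_def by blast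
  define h where "h w = (if w = 0 then L else H (inverse w)) $ i $ j" for w
  have h: "h field_differentiable at 0"
    using L[of i j] unfolding h_def by (rule analytic_on_imp_differentiable_at) simp
  have ev: "eventually (\<lambda>w. h w = H (inverse w) $ i $ j) (at 0)"
    by (simp add: eventually_at_filter h_def)
  have "(h \<longlongrightarrow> h 0) (at 0)"
    using field_differentiable_imp_continuous_at[OF h] by (simp add: isCont_def)
  then have "((\<lambda>w. H (inverse w) $ i $ j) \<longlongrightarrow> h 0) (at 0)"
    using ev by (rule Lim_transform_eventually)
  then have "((\<lambda>z. H z $ i $ j) \<longlongrightarrow> h 0) at_infinity"
    unfolding at_to_infinity filterlim_filtermap by simp
  moreover have "((\<lambda>z. H z $ i $ j) \<longlongrightarrow> A $ i $ j) at_infinity"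
    by (intro tendsto_intros lim)
  ultimately have "h 0 = A $ i $ j"
    using tendsto_unique[OF trivial_limit_at_infinity] by blast
  then show "(\<lambda>z. norm ((H z - A) $ i $ j)) \<in> O[at_infinity](\<lambda>z. 1 / norm z)"
    using expansion_at_infinity[OF h ev] by simp
qed

section \<open>The Riemann--Hilbert problem for N\<close>

lemma N_matrix_tendsto:
  assumes "(c_fun g a b \<longlongrightarrow> C) F" "(s_fun g a b \<longlongrightarrow> S) F"
    "(F1 \<longlongrightarrow> f1) F" "(F2 \<longlongrightarrow> f2) F" "(G1 \<longlongrightarrow> g1) F" "(G2 \<longlongrightarrow> g2) F"
  shows "(N_matrix g a b F1 F2 G1 G2 \<longlongrightarrow>
    block_matrix (cscale C f1) (cscale S f2) (cscale (- S) g1) (cscale C g2)) F"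
  unfolding N_matrix_def by (intro tendsto_intros assms)

lemma N_matrix_holomorphic:
  assumes "interlaced g a b"
    "matrix_holomorphic_on F1 (slit_plane g a b)" "matrix_holomorphic_on F2 (slit_plane g a b)"
    "matrix_holomorphic_on G1 (slit_plane g a b)" "matrix_holomorphic_on G2 (slit_plane g a b)"
  shows "matrix_holomorphic_on (N_matrix g a b F1 F2 G1 G2) (slit_plane g a b)"
  unfolding matrix_holomorphic_on_def
proof (intro allI)
  fix i j
  note cs = c_fun_holomorphic[OF assms(1), THEN holomorphic_on_subset, OF slit_plane_subset[OF assms(1)]]
    s_fun_holomorphic[OF assms(1), THEN holomorphic_on_subset, OF slit_plane_subset[OF assms(1)]]
  show "(\<lambda>z. N_matrix g a b F1 F2 G1 G2 z $ i $ j) holomorphic_on slit_plane g a b"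
    using assms(2-) unfolding matrix_holomorphic_on_def
    by (cases i; cases j) (auto simp: N_matrix_def cscale_def map_matrix_def intro!: holomorphic_intros cs)
qed

lemma N_matrix_bigo:
  fixes F1 F2 G1 G2 :: "complex \<Rightarrow> complex^'r^'r"
  assumes "(\<lambda>z. norm (c_fun g a b z) * norm (F1 z)) \<in> O[F](h)" "(\<lambda>z. norm (s_fun g a b z) * norm (F2 z)) \<in> O[F](h)"
    "(\<lambda>z. norm (s_fun g a b z) * norm (G1 z)) \<in> O[F](h)" "(\<lambda>z. norm (c_fun g a b z) * norm (G2 z)) \<in> O[F](h)"
  shows "(\<lambda>z. norm (N_matrix g a b F1 F2 G1 G2 z)) \<in> O[F](h)"
  unfolding N_matrix_def
  by (intro block_matrix_bigo) (use assms in \<open>simp_all add: norm_cscale\<close>)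

lemma N_matrix_at_infinity:
  fixes F1 F2 G1 G2 :: "complex \<Rightarrow> complex^'r^'r"
  assumes "matrix_holomorphic_at_infinity F1" "(F1 \<longlongrightarrow> mat 1) at_infinity"
    "matrix_holomorphic_at_infinity G2" "(G2 \<longlongrightarrow> mat 1) at_infinity"
    "(\<lambda>z. norm (F2 z)) \<in> O[at_infinity](\<lambda>_. 1)" "(\<lambda>z. norm (G1 z)) \<in> O[at_infinity](\<lambda>_. 1)"
  shows "(\<lambda>z. norm (N_matrix g a b F1 F2 G1 G2 z - mat 1)) \<in> O[at_infinity](\<lambda>z. 1 / norm z)"
proof -
  have diag: "(\<lambda>z. norm (cscale (c_fun g a b z) (P z) - mat 1)) \<in> O[at_infinity](\<lambda>z. 1 / norm z)"
    if "matrix_holomorphic_at_infinity P" "(P \<longlongrightarrow> mat 1) at_infinity" for P :: "complex \<Rightarrow> complex^'r^'r"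
  proof -
    have "(\<lambda>z. norm (P z)) \<in> O[at_infinity](\<lambda>_. 1)"
      by (rule bigoI_tendsto[of _ _ "norm (mat 1 :: complex^'r^'r)"]) (use tendsto_norm[OF that(2)] in auto)
    from landau_o.big.mult[OF c_s_at_infinity(1) this]
    have "(\<lambda>z. norm (c_fun g a b z - 1) * norm (P z) + norm (P z - mat 1)) \<in> O[at_infinity](\<lambda>z. 1 / norm z)"
      by (intro sum_in_bigo matrix_expansion_at_infinity that) auto
    then show ?thesis
    proof (rule landau_o.big_trans[rotated], intro bigoI[of _ 1] always_eventually allI)
      fix z
      show "norm (norm (cscale (c_fun g a b z) (P z) - mat 1))
        \<le> 1 * norm (norm (c_fun g a b z - 1) * norm (P z) + norm (P z - mat 1))"
        unfolding cscale_minus_1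
        using norm_triangle_ineq[of "cscale (c_fun g a b z - 1) (P z)" "P z - mat 1"]
        by (simp add: norm_cscale)
    qed
  qed
  have off: "(\<lambda>z. norm (s_fun g a b z) * norm (Q z)) \<in> O[at_infinity](\<lambda>z. 1 / norm z)"
    if "(\<lambda>z. norm (Q z)) \<in> O[at_infinity](\<lambda>_. 1)" for Q :: "complex \<Rightarrow> complex^'r^'r"
    using landau_o.big.mult[OF c_s_at_infinity(2) that] by simp
  show ?thesis
    unfolding N_matrix_def mat_1_eq_block block_matrix_diff
    by (intro block_matrix_bigo diag assms) (use off assms in \<open>simp_all add: norm_cscale\<close>)
qed

text \<open>Both \<open>(c, s)\<close> and each pair of solutions are exchanged on a cut.  In the product \<open>c F\<^sub>1\<close>, say, the limit from above is
  therefore that of \<open>- s F\<^sub>2\<close> from below: the two columns of blocks are exchanged, with one change of sign.\<close>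
lemma N_matrix_cut_jump:
  fixes F1 F2 G1 G2 :: "complex \<Rightarrow> complex^'r^'r"
  assumes il: "interlaced g a b" and k: "k \<le> g" and x: "x \<in> cut a b k"
    and F: "problem_H g a b K F1 F2" and G: "problem_H g a b K G1 G2"
  shows "has_jump (N_matrix g a b F1 F2 G1 G2) (block_matrix 0 (mat 1) (- mat 1) 0) x"
proof -
  obtain C S where cs:
    "(c_fun g a b \<longlongrightarrow> - S) (at_above x)"
    "(s_fun g a b \<longlongrightarrow> C) (at_above x)"
    "(c_fun g a b \<longlongrightarrow> C) (at_below x)"
    "(s_fun g a b \<longlongrightarrow> S) (at_below x)"
    using c_s_cut_limits[OF il k x] .
  have swap: "\<exists>h1 h2. (H1 \<longlongrightarrow> h1) (at_above x) \<and> (H2 \<longlongrightarrow> h2) (at_above x) \<and>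
      (H1 \<longlongrightarrow> h2) (at_below x) \<and> (H2 \<longlongrightarrow> h1) (at_below x)"
    if "problem_H g a b K H1 H2" for H1 H2
  proof -
    have "has_continuous_bvs_on H1 (cut a b k)" "has_continuous_bvs_on H2 (cut a b k)"
      "bv_plus H1 x = bv_minus H2 x" "bv_plus H2 x = bv_minus H1 x"
      using that k x unfolding problem_H_def by blast+
    then show ?thesis using has_continuous_bvs_onD[OF _ x] by metis
  qed
  obtain f1 f2 where f: "(F1 \<longlongrightarrow> f1) (at_above x)" "(F2 \<longlongrightarrow> f2) (at_above x)"
      "(F1 \<longlongrightarrow> f2) (at_below x)" "(F2 \<longlongrightarrow> f1) (at_below x)"
    using swap[OF F] by blast
  obtain g1 g2 where gg: "(G1 \<longlongrightarrow> g1) (at_above x)" "(G2 \<longlongrightarrow> g2) (at_above x)"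
      "(G1 \<longlongrightarrow> g2) (at_below x)" "(G2 \<longlongrightarrow> g1) (at_below x)"
    using swap[OF G] by blast
  define L where "L = block_matrix (cscale C f2) (cscale S f1) (cscale (- S) g2) (cscale C g1)"
  have "L ** block_matrix 0 (mat 1) (- mat 1) 0 =
    block_matrix (cscale (- S) f1) (cscale C f2) (cscale (- C) g1) (cscale (- S) g2)"
    unfolding L_def block_matrix_mult by (simp add: matrix_mult_simps cscale_minus)
  then show ?thesis
    using N_matrix_tendsto[OF cs(1,2) f(1,2) gg(1,2)] N_matrix_tendsto[OF cs(3,4) f(3,4) gg(3,4)]
    unfolding L_def[symmetric] by (intro exI[of _ L]) simp
qed

lemma N_matrix_regular_gap_jump:
  fixes F1 F2 G1 G2 :: "complex \<Rightarrow> complex^'r^'r"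
  assumes il: "interlaced g a b" and j: "j \<in> {1..g}" and x: "x \<in> gap a b j - {xi g a b j}"
    and F: "problem_H g a b K F1 F2" and G: "problem_H g a b K G1 G2"
  shows "has_jump (N_matrix g a b F1 F2 G1 G2) (block_matrix (K j) 0 0 (matrix_inv (K j))) x"
proof -
  have jump: "\<exists>h1 h2. (H1 \<longlongrightarrow> h1 ** K j) (at_above x) \<and>
      (H2 \<longlongrightarrow> h2 ** matrix_inv (K j)) (at_above x) \<and>
      (H1 \<longlongrightarrow> h1) (at_below x) \<and> (H2 \<longlongrightarrow> h2) (at_below x)"
    if "problem_H g a b K H1 H2" for H1 H2
  proof -
    have "has_continuous_bvs_on H1 (gap a b j - {xi g a b j})" "has_continuous_bvs_on H2 (gap a b j - {xi g a b j})"
      "bv_plus H1 x = bv_minus H1 x ** K j" "bv_plus H2 x = bv_minus H2 x ** matrix_inv (K j)"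
      using that j x unfolding problem_H_def by blast+
    then show ?thesis using has_continuous_bvs_onD[OF _ x] by metis
  qed
  obtain f1 f2 where f: "(F1 \<longlongrightarrow> f1 ** K j) (at_above x)" "(F2 \<longlongrightarrow> f2 ** matrix_inv (K j)) (at_above x)"
      "(F1 \<longlongrightarrow> f1) (at_below x)" "(F2 \<longlongrightarrow> f2) (at_below x)"
    using jump[OF F] by blast
  obtain g1 g2 where gg: "(G1 \<longlongrightarrow> g1 ** K j) (at_above x)" "(G2 \<longlongrightarrow> g2 ** matrix_inv (K j)) (at_above x)"
      "(G1 \<longlongrightarrow> g1) (at_below x)" "(G2 \<longlongrightarrow> g2) (at_below x)"
    using jump[OF G] by blast
  have "x \<in> gap a b j" using x by simp
  note cs = c_s_gap_limits[OF il j this]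
  show ?thesis
    using N_matrix_tendsto[OF cs f(1,2) gg(1,2)] N_matrix_tendsto[OF cs f(3,4) gg(3,4)]
    by (intro exI[of _ "block_matrix (cscale (c_fun g a b x) f1) (cscale (s_fun g a b x) f2) (cscale (- s_fun g a b x) g1) (cscale (c_fun g a b x) g2)"])
       (simp add: block_matrix_mult matrix_mult_simps cscale_mult)
qed

lemma nonreal_subset_slit_plane: "{z. Im z \<noteq> 0} \<subseteq> slit_plane g a b"
  by (auto simp: slit_plane_def)

text \<open>In each row of \<open>N\<close> the factor \<open>c\<close> accompanies the solution that is bounded at \<open>\<xi>\<^sub>j\<close>, and \<open>s\<close>, which
  has a zero there, the one that may have a pole.\<close>
lemma N_matrix_bounded_at_xi:
  fixes F1 F2 G1 G2 :: "complex \<Rightarrow> complex^'r^'r"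
  assumes il: "interlaced g a b" and j: "j \<in> {1..g}"
    and F: "normalisation g a b F1 F2" and G: "normalisation g a b G2 G1"
  shows "(\<lambda>z. norm (N_matrix g a b F1 F2 G1 G2 z)) \<in> O[at (of_real (xi g a b j)) within slit_plane g a b](\<lambda>_. 1)"
proof -
  let ?x = "complex_of_real (xi g a b j)" let ?T = "slit_plane g a b"
  have c: "(\<lambda>z. norm (c_fun g a b z)) \<in> O[at ?x within ?T](\<lambda>_. 1)"
    by (rule bigoI_tendsto[OF _ ])
       (use tendsto_norm[OF c_s_gap_limits(1)[OF il j xi_props(1)[OF il j]]] in auto)
  have "(\<lambda>z. norm (c_fun g a b z) * norm (P z)) \<in> O[at ?x within ?T](\<lambda>_. 1)"
       "(\<lambda>z. norm (s_fun g a b z) * norm (Q z)) \<in> O[at ?x within ?T](\<lambda>_. 1)"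
    if "normalisation g a b P Q" for P Q :: "complex \<Rightarrow> complex^'r^'r"
  proof -
    have PQ: "(\<lambda>z. norm (P z)) \<in> O[at ?x within ?T](\<lambda>_. 1)"
      "(\<lambda>z. norm (Q z)) \<in> O[at ?x within ?T](\<lambda>z. 1 / norm (z - ?x))"
      using that j unfolding normalisation_def by blast+
    show "(\<lambda>z. norm (c_fun g a b z) * norm (P z)) \<in> O[at ?x within ?T](\<lambda>_. 1)"
      using landau_o.big.mult[OF c PQ(1)] by simp
    have "(\<lambda>z. norm (s_fun g a b z) * norm (Q z)) \<in> O[at ?x within ?T](\<lambda>z. norm (z - ?x) * (1 / norm (z - ?x)))"
      by (rule landau_o.big.mult[OF s_fun_xi_bigo[OF il j] PQ(2)])
    also have "(\<lambda>z. norm (z - ?x) * (1 / norm (z - ?x))) \<in> O[at ?x within ?T](\<lambda>_. 1)"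
      by (rule bigoI[of _ 1]) (auto simp: eventually_at_filter)
    finally show "(\<lambda>z. norm (s_fun g a b z) * norm (Q z)) \<in> O[at ?x within ?T](\<lambda>_. 1)" .
  qed
  from this[OF F] this[OF G] show ?thesis by (intro N_matrix_bigo)
qed

text \<open>Away from \<open>\<xi>\<^sub>j\<close> the jump is that of the solutions.  At \<open>\<xi>\<^sub>j\<close>, where Problem H prescribes no boundary
  values, it follows because \<open>N\<close> is bounded and has the jump at the other points of the gap.\<close>
lemma N_matrix_gap_jump:
  fixes F1 F2 G1 G2 :: "complex \<Rightarrow> complex^'r^'r"
  assumes il: "interlaced g a b" and j: "j \<in> {1..g}" and K: "unitary_matrix (K j)" and x: "x \<in> gap a b j"
    and F: "solves_H_F g a b K F1 F2" and G: "solves_H_G g a b K G1 G2"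
  shows "has_jump (N_matrix g a b F1 F2 G1 G2) (block_matrix (K j) 0 0 (matrix_inv (K j))) x"
proof -
  let ?N = "N_matrix g a b F1 F2 G1 G2"
  let ?A = "block_matrix (K j) 0 0 (matrix_inv (K j))"
  have PF: "problem_H g a b K F1 F2" "normalisation g a b F1 F2"
    using F by (simp_all add: solves_H_F_def)
  have PG: "problem_H g a b K G1 G2" "normalisation g a b G2 G1"
    using G by (simp_all add: solves_H_G_def)
  note regular = N_matrix_regular_gap_jump[OF il j _ PF(1) PG(1)]
  define y where "y = xi g a b j"
  show ?thesis
  proof (cases "x = y")
    case False
    then show ?thesis using regular x by (simp add: y_def)
  next
    case True
    define d where "d = min (y - b (j - 1)) (a j - y)"
    have "y \<in> gap a b j" using xi_props(1)[OF il j] by (simp add: y_def)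
    then have d: "d > 0" by (simp add: d_def gap_def)
    have punct: "{y - d<..<y + d} - {y} \<subseteq> gap a b j - {xi g a b j}"
      by (auto simp: d_def gap_def y_def)
    have lim: "(?N \<longlongrightarrow> bv_minus ?N t ** ?A) (at_above t) \<and>
        (?N \<longlongrightarrow> bv_minus ?N t) (at_below t)"
      if "t \<in> {y - d<..<y + d} - {y}" for t
      using regular[of t] that punct bv_minus_eqI by blast
    show ?thesis
      unfolding True
    proof (rule matrix_limits_at_removable_point[OF d, where Q = "bv_minus ?N"])
      have "matrix_holomorphic_on ?N (slit_plane g a b)"
        by (rule N_matrix_holomorphic[OF il]) (use PF(1) PG(1) in \<open>auto simp: problem_H_def\<close>)
      then show "matrix_holomorphic_on ?N {z. Im z \<noteq> 0}"
        by (auto simp: matrix_holomorphic_on_def intro: holomorphic_on_subset[OF _ nonreal_subset_slit_plane])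
      show "?A ** block_matrix (matrix_inv (K j)) 0 0 (K j) = mat 1"
        by (simp add: block_matrix_mult matrix_mult_simps unitary_inverse[OF K] flip: mat_1_eq_block)
      show "(\<lambda>z. norm (?N z)) \<in> O[at (of_real y) within {z. Im z \<noteq> 0}](\<lambda>_. 1)"
        using N_matrix_bounded_at_xi[OF il j PF(2) PG(2)] unfolding y_def
        by (rule landau_o.big.filter_mono[OF at_le[OF nonreal_subset_slit_plane]])
      show "(?N \<longlongrightarrow> bv_minus ?N t ** ?A) (at_above t)"
        if "t \<in> {y - d<..<y + d} - {y}" for t
        using lim[OF that] ..
      show "(?N \<longlongrightarrow> bv_minus ?N t) (at_below t)"
        if "t \<in> {y - d<..<y + d} - {y}" for t
        using lim[OF that] ..
    qed
  qed
qed

lemma N_matrix_endpoint_growth: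
  fixes F1 F2 G1 G2 :: "complex \<Rightarrow> complex^'r^'r"
  assumes il: "interlaced g a b" and e: "e \<in> endpoints g a b"
    and F: "problem_H g a b K F1 F2" and G: "problem_H g a b K G1 G2"
  shows "(\<lambda>z. norm (N_matrix g a b F1 F2 G1 G2 z)) \<in> O[at (of_real e) within slit_plane g a b](
           \<lambda>z. norm (z - of_real e) powr (- 1 / 4))"
proof -
  have bdd: "(\<lambda>z. norm (H z)) \<in> O[at (of_real e) within slit_plane g a b](\<lambda>_. 1)"
    if "H \<in> {F1, F2, G1, G2}" for H
    using that F G e unfolding problem_H_def by blast
  have "(\<lambda>z. norm (f z) * norm (H z)) \<in> O[at (of_real e) within slit_plane g a b](
           \<lambda>z. norm (z - of_real e) powr (- 1 / 4))"
    if "f \<in> {c_fun g a b, s_fun g a b}" "H \<in> {F1, F2, G1, G2}" for f H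
    using landau_o.big.mult[OF c_s_endpoint_growth(1)[OF il e] bdd[OF that(2)]]
      landau_o.big.mult[OF c_s_endpoint_growth(2)[OF il e] bdd[OF that(2)]] that(1) by auto
  then show ?thesis by (intro N_matrix_bigo) auto
qed

theorem proposition4p5:
  fixes g :: nat and a b :: "nat \<Rightarrow> real"
    and K :: "nat \<Rightarrow> complex^'r^'r"
    and F1 F2 G1 G2 :: "complex \<Rightarrow> complex^'r^'r"
  assumes "interlaced g a b"
    and "\<And>j. j \<in> {1..g} \<Longrightarrow> unitary_matrix (K j)"
    and "solves_H_F g a b K F1 F2"
    and "solves_H_G g a b K G1 G2"
  shows "solves_RHP_N g a b K (N_matrix g a b F1 F2 G1 G2)"
proof -
  have F: "problem_H g a b K F1 F2" "normalisation g a b F1 F2"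
    using assms(3) by (simp_all add: solves_H_F_def)
  have G: "problem_H g a b K G1 G2" "normalisation g a b G2 G1"
    using assms(4) by (simp_all add: solves_H_G_def)
  have hol: "matrix_holomorphic_on H (slit_plane g a b)" "matrix_holomorphic_at_infinity H"
    if "H \<in> {F1, F2, G1, G2}" for H
    using that F(1) G(1) unfolding problem_H_def by blast+
  note on_cut = jump_from_limits[OF N_matrix_cut_jump[OF assms(1) _ _ F(1) G(1)]]
  note on_gap = jump_from_limits[OF N_matrix_gap_jump[where K = K, OF assms(1) _ assms(2) _ assms(3,4)]]
  show ?thesis
    unfolding solves_RHP_N_def
  proof (intro conjI allI impI ballI)
    show "matrix_holomorphic_on (N_matrix g a b F1 F2 G1 G2) (slit_plane g a b)"
      by (intro N_matrix_holomorphic assms(1) hol) auto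
    show "(\<lambda>z. norm (N_matrix g a b F1 F2 G1 G2 z - mat 1)) \<in> O[at_infinity](\<lambda>z. 1 / norm z)"
      by (intro N_matrix_at_infinity hol) (use F(2) G(2) in \<open>auto simp: normalisation_def\<close>)
    show "(\<lambda>z. norm (N_matrix g a b F1 F2 G1 G2 z)) \<in> O[at (of_real e) within slit_plane g a b](
           \<lambda>z. norm (z - of_real e) powr (- 1 / 4))" if "e \<in> endpoints g a b" for e
      by (rule N_matrix_endpoint_growth[OF assms(1) that F(1) G(1)])
  qed (use on_cut on_gap in simp_all)
qed

end
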